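(* Let $C_1,C_2>0$, let $(x_d,y_d)\in\mathbb{R}^2$, and put $J(x,y)=C_1(x-x_d)^4+C_2(y-y_d)^4$. Let $a,c>0$ be design constants, let $\Omega$ be the constant angular velocity, and let $\varepsilon>0$ be a small parameter. Consider the unicycle system $$ \begin{aligned} \dot x&=2\Big(\frac{2\pi}{\varepsilon}\Big)^{3/4}\Big(3c\,J(x,y)\sin\frac{6\pi t}{\varepsilon}+a\cos\frac{2\pi t}{\varepsilon}\Big)\cos(\Omega t),\\ \dot y&=2\Big(\frac{2\pi}{\varepsilon}\Big)^{3/4}\Big(3c\,J(x,y)\sin\frac{6\pi t}{\varepsilon}+a\cos\frac{2\pi t}{\varepsilon}\Big)\sin(\Omega t). \end{aligned} $$ This system is practically exponentially stable for any compact set $D\subset\mathbb{R}^2$ such that $(x_d,y_d)\in D$.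
   Context: The system is the extremum seeking unicycle design without the optional high-pass filter: the filter state $h$ is set to $0$ and its dynamical equation is omitted. Here $(x,y)$ is the position of the unicycle, $J$ is the objective function, with minimum at $(x_d,y_d)$, and the factor multiplying $\cos(\Omega t)$ and $\sin(\Omega t)$ is the linear velocity. Write $X=(x,y)$, $X_d=(x_d,y_d)$, and let $\|\cdot\|$ be the Euclidean norm. Practical exponential stability is expressed by the following estimate: for any initial condition $X(0)$ there exist $q_1>0$, $q_2>0$ and $d(\varepsilon)$ with $d(\varepsilon)\to0$ as $\varepsilon\to0$ such that $$\|X(t)-X_d\|\le q_1e^{-q_2t}+d(\varepsilon),\qquad \forall\, T>0 \text{ and } t\in[0,T].$$ That is, for any positive time $T$, which can be made as large as needed, the trajectories decay exponentially to a neighborhood of $X_d$, and this neighborhood can be made arbitrarily small via the parameter $\varepsilon$.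
   Formalization: The angular velocity Ω is assumed nonzero: for Ω = 0 the second equation gives ẏ = 0, so y(t) = y(0) and the claimed decay fails for any initial condition with y(0) ≠ y_d. *)

theory Defs
  imports "HOL-Analysis.Analysis"
begin

definition quartic_cost :: "real \<Rightarrow> real \<Rightarrow> real \<times> real \<Rightarrow> real \<times> real \<Rightarrow> real" where
  "quartic_cost C1 C2 Xd X = C1 * (fst X - fst Xd) ^ 4 + C2 * (snd X - snd Xd) ^ 4"

text \<open>Linear velocity and closed-loop right-hand side of the extremum seeking unicycle
  (no high-pass filter) for a given objective \<open>J\<close>; the heading angle is \<open>\<Omega> t\<close>.\<close>

definition unicycle_velocity ::
    "(real \<times> real \<Rightarrow> real) \<Rightarrow> real \<Rightarrow> real \<Rightarrow> real \<Rightarrow> real \<Rightarrow> real \<times> real \<Rightarrow> real" where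
  "unicycle_velocity J a c \<epsilon> t X =
     2 * (2 * pi / \<epsilon>) powr (3 / 4) *
       (3 * c * J X * sin (6 * pi * t / \<epsilon>) + a * cos (2 * pi * t / \<epsilon>))"

definition unicycle_field ::
    "(real \<times> real \<Rightarrow> real) \<Rightarrow> real \<Rightarrow> real \<Rightarrow> real \<Rightarrow> real \<Rightarrow> real \<Rightarrow> real \<times> real \<Rightarrow> real \<times> real" where
  "unicycle_field J a c \<Omega> \<epsilon> t X =
     (unicycle_velocity J a c \<epsilon> t X * cos (\<Omega> * t),
      unicycle_velocity J a c \<epsilon> t X * sin (\<Omega> * t))"

definition ivp_solution ::
    "(real \<Rightarrow> 'a \<Rightarrow> 'a) \<Rightarrow> 'a::real_normed_vector \<Rightarrow> real \<Rightarrow> (real \<Rightarrow> 'a) \<Rightarrow> bool" where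
  "ivp_solution f X0 T X \<longleftrightarrow>
     X 0 = X0 \<and> (\<forall>t\<in>{0..T}. (X has_vector_derivative f t (X t)) (at t within {0..T}))"

text \<open>
  Practical exponential stability, for initial conditions in \<open>D\<close>, of the \<open>\<epsilon>\<close>-dependent system
  \<open>X' = F \<epsilon> t X\<close>. The parameter range \<open>0 < \<epsilon> < \<epsilon>0\<close> may depend on \<open>D\<close>; the constants \<open>q1\<close>, \<open>q2\<close> and
  the residual \<open>d\<close> may depend on the initial condition, but not on \<open>\<epsilon>\<close> (except as the argument
  of \<open>d\<close>) nor on the horizon \<open>T\<close>. A solution is required to exist on each \<open>[0, T]\<close>, so that the
  estimate is not vacuous in the case of finite escape time.
\<close>

definition practically_exponentially_stable ::
    "(real \<Rightarrow> real \<Rightarrow> 'a \<Rightarrow> 'a) \<Rightarrow> 'a::real_normed_vector \<Rightarrow> 'a set \<Rightarrow> bool" where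
  "practically_exponentially_stable F Xd D \<longleftrightarrow>
     (\<exists>\<epsilon>0>0. \<forall>X0\<in>D. \<exists>q1>0. \<exists>q2>0. \<exists>d :: real \<Rightarrow> real. (d \<longlongrightarrow> 0) (at_right 0) \<and>
        (\<forall>\<epsilon>. 0 < \<epsilon> \<and> \<epsilon> < \<epsilon>0 \<longrightarrow>
          (\<forall>T>0.
             (\<exists>X. ivp_solution (F \<epsilon>) X0 T X) \<and>
             (\<forall>X. ivp_solution (F \<epsilon>) X0 T X \<longrightarrow>
                (\<forall>t\<in>{0..T}. norm (X t - Xd) \<le> q1 * exp (- q2 * t) + d \<epsilon>)))))"

end

theory Submission imports Defs begin

text \<open>With \<open>\<delta> = (\<epsilon> / 2\<pi>)\<^bsup>1/4\<^esup>\<close> and \<open>e = (cos \<Omega>t, sin \<Omega>t)\<close> the system is a fast oscillation of amplitude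
  \<open>\<delta>\<^bsup>-3\<^esup>\<close> and frequency \<open>\<delta>\<^bsup>-4\<^esup>\<close> along the slowly turning direction \<open>e\<close>. Four integrations by parts in time
  remove it; up to an error \<open>O(\<delta>)\<close>, the only resonant word is \<open>cos, cos, cos, sin 3\<close>, which leaves
  \<open>-a\<^sup>3 c\<close> times the third derivative of \<open>J\<close> along \<open>e\<close>, that is, the linear system
  \<open>z' = -K \<xi> e\<close>, \<open>\<xi> = C1 x cos\<^sup>3 \<Omega>t + C2 y sin\<^sup>3 \<Omega>t\<close>, \<open>K = 24 a\<^sup>3 c\<close>.
  The function \<open>V = C1\<^bsup>1/3\<^esup> x\<^bsup>4/3\<^esup> + C2\<^bsup>1/3\<^esup> y\<^bsup>4/3\<^esup>\<close> decreases along it, because \<open>A + B\<close> and \<open>A\<^sup>3 + B\<^sup>3\<close>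
  have the same sign; quantitatively \<open>V\<^bsup>3/2\<^esup>\<close>, which is comparable to \<open>|z|\<^sup>2\<close>, has derivative at most
  \<open>-const \<xi>\<^sup>2\<close>. Adding a small multiple of a time-periodic quadratic form whose time derivative is \<open>\<xi>\<^sup>2\<close> minus
  its mean over the heading makes the decrease strict, and a Gronwall and continuation argument transfers
  the exponential decay to the original system up to \<open>O(\<delta>\<^bsup>1/2\<^esup>)\<close>.\<close>

section \<open>Differential inequalities and existence of solutions\<close>

text \<open>Multiplying \<open>u - b / l\<close> by the integrating factor
  \<open>exp (l * t)\<close> gives a function whose derivative \<open>w'\<close> is nonpositive. The
  derivative of \<open>u\<close> is only asked for existentially, the form in which
  \<open>dissipative\<close> supplies it.\<close>

lemma gronwall_dissipative:
  fixes u :: "real \<Rightarrow> real"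
  assumes "\<And>t. t \<in> {0..S} \<Longrightarrow> \<exists>D. (u has_real_derivative D) (at t within {0..S}) \<and> D \<le> - l * u t + b"
    and "0 < l" "0 \<le> b" "t \<in> {0..S}"
  shows "u t \<le> exp (- l * t) * u 0 + b / l"
proof -
  from assms(1) obtain D where D: "\<And>t. t \<in> {0..S} \<Longrightarrow> (u has_real_derivative D t) (at t within {0..S})"
    "\<And>t. t \<in> {0..S} \<Longrightarrow> D t \<le> - l * u t + b"
    by metis
  define w where "w = (\<lambda>s. exp (l * s) * (u s - b / l))"
  define w' where "w' = (\<lambda>s. exp (l * s) * (D s + l * u s - b))"
  have "(w has_real_derivative w' s) (at s within {0..t})" if "0 \<le> s" "s \<le> t" for s
  proof -
    have "(u has_real_derivative D s) (at s within {0..t})"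
      by (rule DERIV_subset[OF D(1)]) (use that assms(4) in auto)
    moreover have "((\<lambda>s. exp (l * s)) has_real_derivative exp (l * s) * l) (at s within {0..t})"
      by (auto intro!: derivative_eq_intros)
    ultimately have "((\<lambda>s. exp (l * s) * (u s - b / l)) has_real_derivative
        exp (l * s) * l * (u s - b / l) + (D s - 0) * exp (l * s)) (at s within {0..t})"
      by (intro DERIV_mult DERIV_diff DERIV_const)
    then show ?thesis
      unfolding w_def w'_def by (rule DERIV_cong) (use assms(2) in \<open>simp add: algebra_simps\<close>)
  qed
  then have "\<exists>s\<in>{0..t}. w t - w 0 = (t - 0) * w' s"
    using mvt_very_simple[of 0 t w "\<lambda>s h. w' s * h"] assms(4)
    by (simp add: has_field_derivative_def mult.commute[of t])
  then obtain s where s: "s \<in> {0..t}" "w t - w 0 = (t - 0) * w' s" by blast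
  have "w' s \<le> 0"
    using D(2)[of s] s assms(4) unfolding w'_def by (intro mult_nonneg_nonpos) auto
  then have "w t \<le> w 0"
    using s assms(4) mult_nonneg_nonpos[of t "w' s"] by simp
  then have "exp (- l * t) * (exp (l * t) * (u t - b / l)) \<le> exp (- l * t) * (u 0 - b / l)"
    by (intro mult_left_mono) (auto simp: w_def)
  then have "u t - b / l \<le> exp (- l * t) * u 0 - exp (- l * t) * (b / l)"
    by (simp add: mult.assoc[symmetric] exp_add[symmetric] right_diff_distrib)
  moreover have "0 \<le> exp (- l * t) * (b / l)" using assms(2,3) by simp
  ultimately show ?thesis by linarith
qed

text \<open>At the first time where \<open>g\<close> reaches \<open>M\<close> it equals
  \<open>M\<close> by the intermediate value theorem, and earlier values lie below \<open>M\<close>,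
  so \<open>step\<close> gives a contradiction. It serves to turn an estimate valid inside a ball
  into the fact that a trajectory never leaves the ball.\<close>

lemma continuous_bootstrap:
  fixes g :: "real \<Rightarrow> real"
  assumes cont: "continuous_on {0..S} g" and "g 0 < M"
    and step: "\<And>s. s \<in> {0..S} \<Longrightarrow> (\<And>t. t \<in> {0..s} \<Longrightarrow> g t \<le> M) \<Longrightarrow> g s < M"
    and "t \<in> {0..S}"
  shows "g t < M"
proof (rule ccontr)
  assume "\<not> g t < M"
  define B where "B = {t \<in> {0..S}. M \<le> g t}"
  have "B = {0..S} \<inter> g -` {M..}" by (auto simp: B_def)
  then have "closed B"
    using continuous_closed_preimage[OF cont closed_atLeastAtMost closed_atLeast, of M] by simp
  moreover have "B \<subseteq> {0..S}" by (auto simp: B_def)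
  ultimately have B: "compact B" "B \<noteq> {}"
    using assms(4) \<open>\<not> g t < M\<close> compact_Int_closed[OF compact_Icc, of B 0 S]
    by (auto simp: Int_absorb1 B_def)
  obtain s where s: "s \<in> B" "\<And>u. u \<in> B \<Longrightarrow> s \<le> u"
    using compact_attains_inf[OF B] by blast
  then have sS: "s \<in> {0..S}" "M \<le> g s" by (auto simp: B_def)
  have "g s = M"
  proof -
    obtain u where u: "0 \<le> u" "u \<le> s" "g u = M"
      using IVT'[of g 0 M s] sS assms(2) continuous_on_subset[OF cont, of "{0..s}"] by auto
    then have "u \<in> B" using sS by (auto simp: B_def)
    then show ?thesis using s(2) u by force
  qed
  moreover have "g u < M" if "u \<in> {0..s}" "u \<noteq> s" for u
    using s(2)[of u] that sS by (force simp: B_def)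
  ultimately have "g u \<le> M" if "u \<in> {0..s}" for u
    using that by (cases "u = s") (auto intro: less_imp_le)
  then show False using step[OF sS(1)] sS(2) by force
qed

text \<open>Picard iteration for the weighted unknown
  \<open>exp (- 2 * L * t) *\<^sub>R X t\<close>. The weight makes the integral operator a
  contraction with factor 1/2 on the whole horizon, however long, so no short intervals have to be
  glued together.\<close>

lemma picard_global:
  fixes f :: "real \<Rightarrow> 'a::euclidean_space \<Rightarrow> 'a"
  assumes T: "0 \<le> T" and L: "0 < L"
    and cont: "continuous_on ({0..T} \<times> UNIV) (\<lambda>(t, x). f t x)"
    and lip: "\<And>t x y. t \<in> {0..T} \<Longrightarrow> norm (f t x - f t y) \<le> L * norm (x - y)"
  shows "\<exists>X. ivp_solution f X0 T X"
proof -
  define g where "g = (\<lambda>v s. f s (exp (2 * L * s) *\<^sub>R v s))"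
  define h where "h = (\<lambda>v t. exp (- 2 * L * t) *\<^sub>R (X0 + integral {0..t} (g v)))"
  \<comment> \<open>Clamping the time to \<open>{0..T}\<close> extends functions by constants, so
    the iteration lives in the complete space of bounded continuous functions on the line.\<close>
  define cl where "cl = (\<lambda>t. max 0 (min T t))"
  have clT: "cl t \<in> {0..T}" for t using T by (simp add: cl_def)
  have contcl: "continuous_on UNIV cl" unfolding cl_def by (intro continuous_intros)
  have gc: "continuous_on {0..T} (g v)" if "continuous_on {0..T} v" for v
  proof -
    have "continuous_on {0..T} (\<lambda>s. (s, exp (2 * L * s) *\<^sub>R v s))"
      by (intro continuous_intros that)
    from continuous_on_compose2[OF cont this] show ?thesis
      by (auto simp: g_def)
  qed
  have hc: "continuous_on {0..T} (h v)" if "continuous_on {0..T} v" for v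
    unfolding h_def
    by (intro continuous_intros indefinite_integral_continuous_1 integrable_continuous_real gc that)
  have bc: "(\<lambda>t. h v (cl t)) \<in> bcontfun" if "continuous_on {0..T} v" for v
  proof -
    have "bounded (h v ` {0..T})"
      by (intro compact_imp_bounded compact_continuous_image hc that compact_Icc)
    moreover have "range (\<lambda>t. h v (cl t)) \<subseteq> h v ` {0..T}" using clT by blast
    moreover have "continuous_on UNIV (\<lambda>t. h v (cl t))"
      by (rule continuous_on_compose2[OF hc[OF that] contcl]) (use clT in blast)
    ultimately show ?thesis unfolding bcontfun_def by (auto intro: bounded_subset)
  qed
  define P :: "(real \<Rightarrow>\<^sub>C 'a) \<Rightarrow> (real \<Rightarrow>\<^sub>C 'a)" where "P = (\<lambda>v. Bcontfun (\<lambda>t. h (apply_bcontfun v) (cl t)))"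
  have P: "apply_bcontfun (P v) t = h (apply_bcontfun v) (cl t)" for v t
    unfolding P_def using bc[of "apply_bcontfun v"] by (simp add: Bcontfun_inverse)
  have contr: "dist (P v) (P w) \<le> 1 / 2 * dist v w" for v w
  proof (rule dist_bound)
    fix t
    define s where "s = cl t"
    have s: "0 \<le> s" "s \<le> T" using clT[of t] by (auto simp: s_def)
    let ?v = "apply_bcontfun v" and ?w = "apply_bcontfun w"
    have int: "(g ?v) integrable_on {0..s}" "(g ?w) integrable_on {0..s}"
      using s by (auto intro!: integrable_continuous_real continuous_on_subset[OF gc])
    \<comment> \<open>The antiderivative of \<open>L * exp (2 * L * r)\<close> is half of the
      weight: this is the source of the contraction factor 1/2.\<close>
    have e: "((\<lambda>r. L * exp (2 * L * r) * dist v w) has_integral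
        (exp (2 * L * s) / 2 * dist v w - exp (2 * L * 0) / 2 * dist v w)) {0..s}"
      using s L by (intro fundamental_theorem_of_calculus)
        (auto intro!: derivative_eq_intros simp: has_real_derivative_iff_has_vector_derivative[symmetric])
    have "norm (integral {0..s} (\<lambda>r. g ?v r - g ?w r)) \<le> integral {0..s} (\<lambda>r. L * exp (2 * L * r) * dist v w)"
    proof (rule integral_norm_bound_integral)
      fix r assume r: "r \<in> {0..s}"
      have "norm (g ?v r - g ?w r) \<le> L * norm (exp (2 * L * r) *\<^sub>R ?v r - exp (2 * L * r) *\<^sub>R ?w r)"
        unfolding g_def using r s by (intro lip) auto
      also have "\<dots> = L * exp (2 * L * r) * dist (?v r) (?w r)"
        by (simp add: scaleR_right_diff_distrib[symmetric] dist_norm)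
      also have "\<dots> \<le> L * exp (2 * L * r) * dist v w"
        using L by (intro mult_left_mono dist_bounded) auto
      finally show "norm (g ?v r - g ?w r) \<le> L * exp (2 * L * r) * dist v w" .
    qed (use int e in \<open>auto intro: integrable_diff has_integral_integrable\<close>)
    also have "\<dots> \<le> exp (2 * L * s) / 2 * dist v w"
      using integral_unique[OF e] by simp
    finally have b: "norm (integral {0..s} (g ?v) - integral {0..s} (g ?w)) \<le> exp (2 * L * s) / 2 * dist v w"
      using int by (simp add: integral_diff)
    have "dist (h ?v s) (h ?w s) = exp (- 2 * L * s) * norm (integral {0..s} (g ?v) - integral {0..s} (g ?w))"
      by (simp add: h_def dist_norm scaleR_right_diff_distrib[symmetric])
    also have "\<dots> \<le> exp (- 2 * L * s) * (exp (2 * L * s) / 2 * dist v w)"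
      by (intro mult_left_mono b) simp
    also have "\<dots> = 1 / 2 * dist v w"
      by (simp add: mult.assoc[symmetric] exp_add[symmetric])
    finally show "dist (apply_bcontfun (P v) t) (apply_bcontfun (P w) t) \<le> 1 / 2 * dist v w"
      by (simp add: P s_def)
  qed
  obtain v where v: "P v = v"
    using banach_fix_type[of "1 / 2" P] contr by auto
  let ?v = "apply_bcontfun v"
  define X where "X = (\<lambda>t. exp (2 * L * t) *\<^sub>R ?v t)"
  have Xeq: "X t = X0 + integral {0..t} (\<lambda>s. f s (X s))" if "t \<in> {0..T}" for t
  proof -
    have "?v t = h ?v t" using P[of v t] v that by (simp add: cl_def)
    then have "X t = exp (2 * L * t) *\<^sub>R h ?v t" by (simp add: X_def)
    then show ?thesis unfolding h_def g_def X_def[symmetric]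
      by (simp add: exp_add[symmetric] g_def X_def)
  qed
  have "continuous_on {0..T} (\<lambda>s. f s (X s))"
    using gc[of ?v] by (simp add: g_def X_def)
  from integral_has_vector_derivative[OF this]
  have "((\<lambda>t. X0 + integral {0..t} (\<lambda>s. f s (X s))) has_vector_derivative f t (X t)) (at t within {0..T})"
    if "t \<in> {0..T}" for t
    using that by (auto intro!: derivative_eq_intros)
  then have "(X has_vector_derivative f t (X t)) (at t within {0..T})" if "t \<in> {0..T}" for t
    by (rule has_vector_derivative_transform[OF that, rotated]) (use that Xeq in auto)
  moreover have "X 0 = X0" using Xeq[of 0] T by simp
  ultimately show ?thesis unfolding ivp_solution_def by blast
qed

section \<open>Fourth-order averaging\<close>

text \<open>The index ranges over all admissible parameters, horizons \<open>S i\<close> and trajectories at once, so that \<open>bdd\<close>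
  expresses uniform boundedness. The velocity is \<open>f / \<delta>\<^sup>3\<close> with \<open>f = 6 k J sin 3\<tau> + 2 a cos \<tau>\<close>, \<open>\<tau> = t / \<delta>\<^sup>4\<close>,
  where \<open>sin 3\<tau>\<close> is expanded, and \<open>slow p q\<close> says that \<open>q\<close> is the derivative of \<open>p\<close> along the heading.\<close>

locale fast_family =
  fixes I :: "'i set" and \<delta> S :: "'i \<Rightarrow> real" and a k :: real and j0 :: "'i \<Rightarrow> real \<Rightarrow> real"
  assumes \<delta>_bounds: "i \<in> I \<Longrightarrow> 0 < \<delta> i \<and> \<delta> i \<le> 1"
begin

definition sn :: "'i \<Rightarrow> real \<Rightarrow> real" where "sn = (\<lambda>i t. sin (t / \<delta> i ^ 4))"
definition cn :: "'i \<Rightarrow> real \<Rightarrow> real" where "cn = (\<lambda>i t. cos (t / \<delta> i ^ 4))"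
definition f :: "'i \<Rightarrow> real \<Rightarrow> real" where
  "f = (\<lambda>i t. k * j0 i t * (18 * sn i t - 24 * sn i t ^ 3) + 2 * a * cn i t)"

definition bdd :: "('i \<Rightarrow> real \<Rightarrow> real) \<Rightarrow> bool" where
  "bdd \<phi> \<longleftrightarrow> (\<exists>C. \<forall>i\<in>I. \<forall>t\<in>{0..S i}. \<bar>\<phi> i t\<bar> \<le> C)"

definition slow :: "('i \<Rightarrow> real \<Rightarrow> real) \<Rightarrow> ('i \<Rightarrow> real \<Rightarrow> real) \<Rightarrow> bool" where
  "slow p q \<longleftrightarrow> bdd p \<and> bdd q \<and> (\<exists>r. bdd r \<and> (\<forall>i\<in>I. \<forall>t\<in>{0..S i}.
     (p i has_real_derivative f i t * q i t / \<delta> i ^ 3 + r i t) (at t within {0..S i})))"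

text \<open>In the fast time t / \<delta>^4, \<gamma> is an antiderivative of \<psi>. A periodic
  \<psi> has a bounded antiderivative only if its mean vanishes, so over long times boundedness of
  \<gamma> encodes the absence of resonance.\<close>

definition osc :: "('i \<Rightarrow> real \<Rightarrow> real) \<Rightarrow> ('i \<Rightarrow> real \<Rightarrow> real) \<Rightarrow> bool" where
  "osc \<gamma> \<psi> \<longleftrightarrow> bdd \<gamma> \<and> (\<forall>i\<in>I. \<forall>t\<in>{0..S i}.
     (\<gamma> i has_real_derivative \<psi> i t / \<delta> i ^ 4) (at t within {0..S i}))"

text \<open>Up to O(\<delta>), such a term is the time derivative of a quantity of size O(\<delta>),
  so a small change of variables removes it, however large the term itself is.\<close>

definition negl :: "('i \<Rightarrow> real \<Rightarrow> real) \<Rightarrow> bool" where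
  "negl \<phi> \<longleftrightarrow> (\<exists>W R. bdd W \<and> bdd R \<and> (\<forall>i\<in>I. \<forall>t\<in>{0..S i}.
     ((\<lambda>t. \<delta> i * W i t) has_real_derivative \<phi> i t + \<delta> i * R i t) (at t within {0..S i})))"

section \<open>Uniform bounds and derivatives along the heading\<close>

lemma bdd_const [intro]: "bdd (\<lambda>i t. C)"
  unfolding bdd_def by blast

lemma bdd_add [intro]:
  assumes "bdd p" "bdd q" shows "bdd (\<lambda>i t. p i t + q i t)"
proof -
  from assms obtain A B where "\<forall>i\<in>I. \<forall>t\<in>{0..S i}. \<bar>p i t\<bar> \<le> A" "\<forall>i\<in>I. \<forall>t\<in>{0..S i}. \<bar>q i t\<bar> \<le> B"
    unfolding bdd_def by blast
  then have "\<bar>p i t + q i t\<bar> \<le> A + B" if "i \<in> I" "t \<in> {0..S i}" for i t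
    using that by (intro order_trans[OF abs_triangle_ineq add_mono]) auto
  then show ?thesis unfolding bdd_def by blast
qed

lemma bdd_mult [intro]:
  assumes "bdd p" "bdd q" shows "bdd (\<lambda>i t. p i t * q i t)"
proof -
  from assms obtain A B where A: "\<forall>i\<in>I. \<forall>t\<in>{0..S i}. \<bar>p i t\<bar> \<le> A" and B: "\<forall>i\<in>I. \<forall>t\<in>{0..S i}. \<bar>q i t\<bar> \<le> B"
    unfolding bdd_def by blast
  have "\<bar>p i t * q i t\<bar> \<le> \<bar>A\<bar> * \<bar>B\<bar>" if "i \<in> I" "t \<in> {0..S i}" for i t
    unfolding abs_mult using A B that by (intro mult_mono) force+
  then show ?thesis unfolding bdd_def by blast
qed

lemma bdd_minus [intro]: "bdd p \<Longrightarrow> bdd (\<lambda>i t. - p i t)"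
  unfolding bdd_def by simp

lemma bdd_diff [intro]: "bdd p \<Longrightarrow> bdd q \<Longrightarrow> bdd (\<lambda>i t. p i t - q i t)"
  using bdd_add[OF _ bdd_minus] by simp

lemma bdd_power [intro]: "bdd p \<Longrightarrow> bdd (\<lambda>i t. p i t ^ n)"
  by (induction n) auto

lemma bdd_divide [intro]: "bdd p \<Longrightarrow> bdd (\<lambda>i t. p i t / C)"
  using bdd_mult[OF _ bdd_const, of p "1 / C"] by simp

lemma bdd_osc [intro]: "bdd sn" "bdd cn"
  unfolding bdd_def sn_def cn_def by (auto intro!: exI[of _ 1])

lemma bdd_\<delta> [intro]: "bdd (\<lambda>i t. \<delta> i)"
  unfolding bdd_def using \<delta>_bounds by (auto intro!: exI[of _ 1] simp: less_imp_le)

lemma slowE: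
  assumes "slow p q"
  obtains r where "bdd p" "bdd q" "bdd r" "\<And>i t. i \<in> I \<Longrightarrow> t \<in> {0..S i} \<Longrightarrow>
    (p i has_real_derivative f i t * q i t / \<delta> i ^ 3 + r i t) (at t within {0..S i})"
  using assms unfolding slow_def by auto

lemma neglE:
  assumes "negl p"
  obtains W R where "bdd W" "bdd R" "\<And>i t. i \<in> I \<Longrightarrow> t \<in> {0..S i} \<Longrightarrow>
    ((\<lambda>t. \<delta> i * W i t) has_real_derivative p i t + \<delta> i * R i t) (at t within {0..S i})"
  using assms unfolding negl_def by auto

lemma oscD:
  assumes "osc \<gamma> \<psi>"
  shows "bdd \<gamma>" "i \<in> I \<Longrightarrow> t \<in> {0..S i} \<Longrightarrow> (\<gamma> i has_real_derivative \<psi> i t / \<delta> i ^ 4) (at t within {0..S i})"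
  using assms unfolding osc_def by auto

lemma slowI:
  assumes "bdd p" "bdd q" "bdd r" "\<And>i t. i \<in> I \<Longrightarrow> t \<in> {0..S i} \<Longrightarrow>
    (p i has_real_derivative f i t * q i t / \<delta> i ^ 3 + r i t) (at t within {0..S i})"
  shows "slow p q"
  using assms unfolding slow_def by blast

lemma slow_cong:
  assumes "slow p q" "\<And>i t. p i t = p' i t" "\<And>i t. q i t = q' i t" shows "slow p' q'"
proof -
  have "p = p'" "q = q'" using assms(2,3) by blast+
  with assms(1) show ?thesis by simp
qed

lemma slow_const: "slow (\<lambda>i t. C) (\<lambda>i t. 0)"
  unfolding slow_def by (auto intro!: exI[of _ "\<lambda>i t. 0"])

lemma slow_add:
  assumes "slow p p'" "slow q q'"
  shows "slow (\<lambda>i t. p i t + q i t) (\<lambda>i t. p' i t + q' i t)"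
proof -
  obtain r where p: "bdd p" "bdd p'" "bdd r" and dp: "\<And>i t. i \<in> I \<Longrightarrow> t \<in> {0..S i} \<Longrightarrow>
      (p i has_real_derivative f i t * p' i t / \<delta> i ^ 3 + r i t) (at t within {0..S i})"
    by (rule slowE[OF assms(1)], rule that)
  obtain s where q: "bdd q" "bdd q'" "bdd s" and dq: "\<And>i t. i \<in> I \<Longrightarrow> t \<in> {0..S i} \<Longrightarrow>
      (q i has_real_derivative f i t * q' i t / \<delta> i ^ 3 + s i t) (at t within {0..S i})"
    by (rule slowE[OF assms(2)], rule that)
  have "((\<lambda>t. p i t + q i t) has_real_derivative
      f i t * (p' i t + q' i t) / \<delta> i ^ 3 + (r i t + s i t)) (at t within {0..S i})"
    if "i \<in> I" "t \<in> {0..S i}" for i t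
    using DERIV_add[OF dp[OF that] dq[OF that]] by (simp add: ring_distribs add_divide_distrib ac_simps)
  then show ?thesis unfolding slow_def using p q
    by (intro conjI bdd_add exI[of _ "\<lambda>i t. r i t + s i t"] ballI)
qed

lemma slow_mult:
  assumes "slow p p'" "slow q q'"
  shows "slow (\<lambda>i t. p i t * q i t) (\<lambda>i t. p' i t * q i t + p i t * q' i t)"
proof -
  obtain r where p: "bdd p" "bdd p'" "bdd r" and dp: "\<And>i t. i \<in> I \<Longrightarrow> t \<in> {0..S i} \<Longrightarrow>
      (p i has_real_derivative f i t * p' i t / \<delta> i ^ 3 + r i t) (at t within {0..S i})"
    by (rule slowE[OF assms(1)], rule that)
  obtain s where q: "bdd q" "bdd q'" "bdd s" and dq: "\<And>i t. i \<in> I \<Longrightarrow> t \<in> {0..S i} \<Longrightarrow>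
      (q i has_real_derivative f i t * q' i t / \<delta> i ^ 3 + s i t) (at t within {0..S i})"
    by (rule slowE[OF assms(2)], rule that)
  have "((\<lambda>t. p i t * q i t) has_real_derivative
      f i t * (p' i t * q i t + p i t * q' i t) / \<delta> i ^ 3 + (r i t * q i t + p i t * s i t)) (at t within {0..S i})"
    if "i \<in> I" "t \<in> {0..S i}" for i t
    by (rule DERIV_cong[OF DERIV_mult[OF dp[OF that] dq[OF that]]]) (simp add: ring_distribs add_divide_distrib
        ac_simps)
  then show ?thesis unfolding slow_def using p q
    by (intro conjI bdd_add bdd_mult exI[of _ "\<lambda>i t. r i t * q i t + p i t * s i t"] ballI)
qed

lemma slow_power:
  assumes "slow p q"
  shows "slow (\<lambda>i t. p i t ^ Suc n) (\<lambda>i t. real (Suc n) * p i t ^ n * q i t)"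
proof (induction n)
  case 0
  show ?case using assms by simp
next
  case (Suc n)
  show ?case
    by (rule slow_cong[OF slow_mult[OF assms Suc]]) (simp_all add: algebra_simps)
qed

lemma slow_cmult: "slow p q \<Longrightarrow> slow (\<lambda>i t. C * p i t) (\<lambda>i t. C * q i t)"
  using slow_mult[OF slow_const, of p q C] by simp

section \<open>Antiderivatives in the fast time\<close>

lemma osc_basic: "osc sn cn" "osc cn (\<lambda>i t. - sn i t)"
proof -
  have *: "((\<lambda>t. t / \<delta> i ^ 4) has_real_derivative 1 / \<delta> i ^ 4) (at t within {0..S i})" for i t
    by (intro DERIV_cdivide DERIV_ident)
  show "osc sn cn" "osc cn (\<lambda>i t. - sn i t)"
    unfolding osc_def using bdd_osc DERIV_chain2[OF DERIV_sin *] DERIV_chain2[OF DERIV_cos *]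
    by (auto simp: sn_def cn_def)
qed

text \<open>A trigonometric polynomial in the fast time can be written as A(s) + c B(s) with s, c
  its sine and cosine. This lemma and the next treat the two kinds of antiderivative, A(s) and c
  A(s), and reduce the check to a polynomial identity modulo s^2 + c^2 = 1.\<close>

lemma osc_poly:
  assumes "\<And>x. (A has_real_derivative A' x) (at x)" 
    and "bdd (\<lambda>i t. A (sn i t))"
    and "\<And>s c. s\<^sup>2 + c\<^sup>2 = 1 \<Longrightarrow> c * A' s = \<psi> s c"
  shows "osc (\<lambda>i t. A (sn i t)) (\<lambda>i t. \<psi> (sn i t) (cn i t))"
  unfolding osc_def
proof (intro conjI ballI assms(2))
  fix i t assume it: "i \<in> I" "t \<in> {0..S i}"
  have "(sn i has_real_derivative cn i t / \<delta> i ^ 4) (at t within {0..S i})"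
    using osc_basic(1) it unfolding osc_def by blast
  then have "((\<lambda>t. A (sn i t)) has_real_derivative A' (sn i t) * (cn i t / \<delta> i ^ 4)) (at t within {0..S i})"
    by (rule DERIV_chain2[OF assms(1)])
  moreover have "cn i t * A' (sn i t) = \<psi> (sn i t) (cn i t)"
    by (rule assms(3)) (simp add: sn_def cn_def)
  ultimately show "((\<lambda>t. A (sn i t)) has_real_derivative \<psi> (sn i t) (cn i t) / \<delta> i ^ 4) (at t within {0..S i})"
    by (simp add: mult.commute)
qed

lemma osc_poly_cos:
  assumes "\<And>x. (A has_real_derivative A' x) (at x)" 
    and "bdd (\<lambda>i t. A (sn i t))"
    and "\<And>s c. s\<^sup>2 + c\<^sup>2 = 1 \<Longrightarrow> c\<^sup>2 * A' s - s * A s = \<psi> s c"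
  shows "osc (\<lambda>i t. cn i t * A (sn i t)) (\<lambda>i t. \<psi> (sn i t) (cn i t))"
  unfolding osc_def
proof (intro conjI ballI bdd_mult bdd_osc assms(2))
  fix i t assume it: "i \<in> I" "t \<in> {0..S i}"
  have "(sn i has_real_derivative cn i t / \<delta> i ^ 4) (at t within {0..S i})"
    using osc_basic(1) it unfolding osc_def by blast
  then have 1: "((\<lambda>t. A (sn i t)) has_real_derivative A' (sn i t) * (cn i t / \<delta> i ^ 4)) (at t within {0..S i})"
    by (rule DERIV_chain2[OF assms(1)])
  have 2: "(cn i has_real_derivative - sn i t / \<delta> i ^ 4) (at t within {0..S i})"
    using osc_basic(2) it unfolding osc_def by blast
  have *: "(cn i t)\<^sup>2 * A' (sn i t) - sn i t * A (sn i t) = \<psi> (sn i t) (cn i t)"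
    by (rule assms(3)) (simp add: sn_def cn_def)
  show "((\<lambda>t. cn i t * A (sn i t)) has_real_derivative \<psi> (sn i t) (cn i t) / \<delta> i ^ 4) (at t within {0..S i})"
    by (rule DERIV_cong[OF DERIV_mult[OF 2 1]])
       (simp add: *[symmetric] diff_divide_distrib power2_eq_square mult.commute mult.left_commute)
qed

section \<open>Negligible terms and integration by parts\<close>

lemma negl_add:
  assumes "negl p" "negl q" shows "negl (\<lambda>i t. p i t + q i t)"
proof -
  obtain W R where p: "bdd W" "bdd R" and dp: "\<And>i t. i \<in> I \<Longrightarrow> t \<in> {0..S i} \<Longrightarrow>
      ((\<lambda>t. \<delta> i * W i t) has_real_derivative p i t + \<delta> i * R i t) (at t within {0..S i})"
    by (rule neglE[OF assms(1)], rule that)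
  obtain V Q where q: "bdd V" "bdd Q" and dq: "\<And>i t. i \<in> I \<Longrightarrow> t \<in> {0..S i} \<Longrightarrow>
      ((\<lambda>t. \<delta> i * V i t) has_real_derivative q i t + \<delta> i * Q i t) (at t within {0..S i})"
    by (rule neglE[OF assms(2)], rule that)
  have "((\<lambda>t. \<delta> i * (W i t + V i t)) has_real_derivative
      p i t + q i t + \<delta> i * (R i t + Q i t)) (at t within {0..S i})"
    if "i \<in> I" "t \<in> {0..S i}" for i t
    using DERIV_add[OF dp[OF that] dq[OF that]] by (simp add: algebra_simps)
  then show ?thesis unfolding negl_def using p q
    by (intro exI[of _ "\<lambda>i t. W i t + V i t"] exI[of _ "\<lambda>i t. R i t + Q i t"] conjI ballI bdd_add)
qed

lemma negl_cong:
  assumes "negl p" "\<And>i t. i \<in> I \<Longrightarrow> t \<in> {0..S i} \<Longrightarrow> p i t = q i t" shows "negl q"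
  using assms unfolding negl_def by simp

text \<open>Integration by parts: a fast oscillation \<open>\<psi>\<close> of amplitude \<open>\<delta> ^ (m - 4)\<close> is traded for
  one of amplitude \<open>\<delta> ^ (m - 3)\<close>.\<close>

lemma negl_by_parts:
  assumes "osc \<gamma> \<psi>" "slow p q" "m \<ge> 1"
  shows "negl (\<lambda>i t. \<delta> i ^ m / \<delta> i ^ 4 * \<psi> i t * p i t + \<delta> i ^ m / \<delta> i ^ 3 * \<gamma> i t * f i t * q i t)"
proof -
  obtain r where p: "bdd p" "bdd q" "bdd r" and dp: "\<And>i t. i \<in> I \<Longrightarrow> t \<in> {0..S i} \<Longrightarrow>
      (p i has_real_derivative f i t * q i t / \<delta> i ^ 3 + r i t) (at t within {0..S i})"
    by (rule slowE[OF assms(2)], rule that)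
  note \<gamma> = oscD[OF assms(1)]
  \<comment> \<open>With \<open>m \<ge> 1\<close> one factor \<delta> can be split off from
    \<open>\<delta> i ^ m\<close>; it is the one in front of \<open>W\<close> and \<open>R\<close>
    in \<open>negl\<close>.\<close>
  obtain n where m: "m = Suc n" using assms(3) by (cases m) auto
  have "((\<lambda>t. \<delta> i * (\<delta> i ^ n * (\<gamma> i t * p i t))) has_real_derivative
      (\<delta> i ^ m / \<delta> i ^ 4 * \<psi> i t * p i t + \<delta> i ^ m / \<delta> i ^ 3 * \<gamma> i t * f i t * q i t) +
      \<delta> i * (\<delta> i ^ n * (\<gamma> i t * r i t))) (at t within {0..S i})"
    if "i \<in> I" "t \<in> {0..S i}" for i t
    by (rule DERIV_cong[OF DERIV_cmult[OF DERIV_cmult[OF DERIV_mult[OF \<gamma>(2)[OF that] dp[OF that]]]]])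
       (simp add: m ring_distribs ac_simps)
  then show ?thesis unfolding negl_def using p \<gamma>(1)
    by (intro exI[of _ "\<lambda>i t. \<delta> i ^ n * (\<gamma> i t * p i t)"] exI[of _ "\<lambda>i t. \<delta> i ^ n * (\<gamma> i t * r i t)"]
          conjI ballI bdd_mult bdd_power bdd_\<delta>)
qed

lemma negl_small:
  assumes "bdd b" shows "negl (\<lambda>i t. \<delta> i * b i t)"
  unfolding negl_def using assms
  by (intro exI[of _ "\<lambda>i t. 0"] exI[of _ "\<lambda>i t. - b i t"]) (simp add: bdd_minus bdd_const)

text \<open>This is the case m = 4: the remainder of the integration by parts is already \<delta>
  times a bounded function, so it is discarded and no further antiderivative is needed.\<close>

lemma negl_by_parts_last:
  assumes "osc \<gamma> \<psi>" "slow p q" "bdd f"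
  shows "negl (\<lambda>i t. \<psi> i t * p i t)"
proof (rule negl_cong[OF negl_add[OF negl_by_parts[OF assms(1,2), of 4] negl_small]])
  have "bdd \<gamma>" "bdd q"
    using assms(1,2) by (auto elim: slowE dest: oscD)
  then show "bdd (\<lambda>i t. - (\<gamma> i t * f i t * q i t))"
    by (intro bdd_mult bdd_minus assms(3))
next
  fix i t assume "i \<in> I"
  then have "\<delta> i ^ 4 / \<delta> i ^ 4 = 1" "\<delta> i ^ 4 / \<delta> i ^ 3 = \<delta> i"
    using \<delta>_bounds[of i] by (auto simp: eval_nat_numeral)
  then show "\<delta> i ^ 4 / \<delta> i ^ 4 * \<psi> i t * p i t + \<delta> i ^ 4 / \<delta> i ^ 3 * \<gamma> i t * f i t * q i t
      + \<delta> i * - (\<gamma> i t * f i t * q i t) = \<psi> i t * p i t"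
    by simp
qed simp

text \<open>Each integration by parts replaces a term by minus its remainder, which contains
  \<open>f\<close>; splitting \<open>f\<close> into its two letters \<open>b\<close> and
  \<open>cn\<close> produces the words of the next level. The words of level m have amplitude
  \<delta> to the power m - 4, so at level four only the mean of a word survives.\<close>

lemma fourth_order_average:
  assumes j01: "slow j0 j1" and j12: "slow j1 j2" and j23: "slow j2 j3" and j34: "slow j3 j4"
  shows "negl (\<lambda>i t. f i t / \<delta> i ^ 3 + a ^ 3 * k * j3 i t)"
proof -
  txt \<open>The products integrated below are those of the successive antiderivatives with the two letters \<open>b\<close> and \<open>cn\<close>;
    \<open>g5 * cn\<close> is the only one whose mean, \<open>1 / 8\<close>, does not vanish.\<close>
  define b where "b = (\<lambda>i t. 18 * sn i t - 24 * sn i t ^ 3)"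
  \<comment> \<open>Here \<open>b\<close> is 6 sin 3\<tau> and \<open>g1\<close> is -2 cos 3\<tau>,
    both expanded in \<open>sn\<close> and \<open>cn\<close>.\<close>
  define g1 where "g1 = (\<lambda>i t. cn i t * (- 2 + 8 * sn i t ^ 2))"
  define g2 where "g2 = (\<lambda>i t. cn i t * (- 2 * sn i t + 2 * sn i t ^ 3))"
  define g3 where "g3 = (\<lambda>i t. 2 * sn i t - 6 * sn i t ^ 3 + 48/5 * sn i t ^ 5 - 32/7 * sn i t ^ 7)"
  define g4 where "g4 = (\<lambda>i t. - 12 * sn i t ^ 3 + 84/5 * sn i t ^ 5 - 48/7 * sn i t ^ 7)"
  define g5 where "g5 = (\<lambda>i t. cn i t * (2/5 - 4/5 * sn i t ^ 2 + 2/5 * sn i t ^ 4))"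
  have o1: "osc g1 (\<lambda>i t. b i t)"
    unfolding g1_def b_def
  proof (rule osc_poly_cos[where A = "\<lambda>s. - 2 + 8 * s ^ 2" and \<psi> = "\<lambda>s c. (18 * s - 24 * s ^ 3)"
      and A' = "\<lambda>s. 16 * s"])
    fix s c :: real assume "s\<^sup>2 + c\<^sup>2 = 1"
    then show "c\<^sup>2 * (16 * s) - s * (- 2 + 8 * s ^ 2) = (18 * s - 24 * s ^ 3)"
      by algebra
  qed (auto intro!: derivative_eq_intros bdd_add bdd_diff bdd_minus bdd_mult bdd_divide bdd_power)
  have o2: "osc g2 (\<lambda>i t. g1 i t * cn i t)"
    unfolding g1_def g2_def
  proof (rule osc_poly_cos[where A = "\<lambda>s. - 2 * s + 2 * s ^ 3" and \<psi> = "\<lambda>s c. (c * (- 2 + 8 * s ^ 2)) * c"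
      and A' = "\<lambda>s. - 2 + 6 * s ^ 2"])
    fix s c :: real assume "s\<^sup>2 + c\<^sup>2 = 1"
    then show "c\<^sup>2 * (- 2 + 6 * s ^ 2) - s * (- 2 * s + 2 * s ^ 3) = (c * (- 2 + 8 * s ^ 2)) * c"
      by algebra
  qed (auto intro!: derivative_eq_intros bdd_add bdd_diff bdd_minus bdd_mult bdd_divide bdd_power)
  have o3: "osc g3 (\<lambda>i t. g1 i t ^ 2 / 2 * cn i t)"
    unfolding g1_def g3_def
  proof (rule osc_poly[where A = "\<lambda>s. 2 * s - 6 * s ^ 3 + 48/5 * s ^ 5 - 32/7 * s ^ 7" and \<psi> = "\<lambda>s c. (c * (- 2
      + 8 * s ^ 2)) ^ 2 / 2 * c"
      and A' = "\<lambda>s. 2 - 18 * s ^ 2 + 48 * s ^ 4 - 32 * s ^ 6"])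
    fix s c :: real assume "s\<^sup>2 + c\<^sup>2 = 1"
    then show "c * (2 - 18 * s ^ 2 + 48 * s ^ 4 - 32 * s ^ 6) = (c * (- 2 + 8 * s ^ 2)) ^ 2 / 2 * c"
      by algebra
  qed (auto intro!: derivative_eq_intros bdd_add bdd_diff bdd_minus bdd_mult bdd_divide bdd_power)
  have o4: "osc g4 (\<lambda>i t. g2 i t * b i t)"
    unfolding g2_def g4_def b_def
  proof (rule osc_poly[where A = "\<lambda>s. - 12 * s ^ 3 + 84/5 * s ^ 5 - 48/7 * s ^ 7" and \<psi> = "\<lambda>s c. (c * (- 2 * s +
      2 * s ^ 3)) * (18 * s - 24 * s ^ 3)"
      and A' = "\<lambda>s. - 36 * s ^ 2 + 84 * s ^ 4 - 48 * s ^ 6"])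
    fix s c :: real
    show "c * (- 36 * s ^ 2 + 84 * s ^ 4 - 48 * s ^ 6) = (c * (- 2 * s + 2 * s ^ 3)) * (18 * s - 24 * s ^ 3)"
      by algebra
  qed (auto intro!: derivative_eq_intros bdd_add bdd_diff bdd_minus bdd_mult bdd_divide bdd_power)
  have o5: "osc g5 (\<lambda>i t. g2 i t * cn i t)"
    unfolding g2_def g5_def
  proof (rule osc_poly_cos[where A = "\<lambda>s. 2/5 - 4/5 * s ^ 2 + 2/5 * s ^ 4" and \<psi> = "\<lambda>s c. (c * (- 2 * s + 2 * s
      ^ 3)) * c"
      and A' = "\<lambda>s. - 8/5 * s + 8/5 * s ^ 3"])
    fix s c :: real assume "s\<^sup>2 + c\<^sup>2 = 1"
    then show "c\<^sup>2 * (- 8/5 * s + 8/5 * s ^ 3) - s * (2/5 - 4/5 * s ^ 2 + 2/5 * s ^ 4) = (c * (- 2 * s + 2 * s ^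
        3)) * c"
      by algebra
  qed (auto intro!: derivative_eq_intros bdd_add bdd_diff bdd_minus bdd_mult bdd_divide bdd_power)
  have h1: "osc (\<lambda>i t. cn i t * (12 * sn i t ^ 3 - 108/5 * sn i t ^ 5 + 936/35 * sn i t ^ 7 - 384/35 * sn i t ^
      9)) (\<lambda>i t. g3 i t * b i t)"
    unfolding g3_def b_def
  proof (rule osc_poly_cos[where A = "\<lambda>s. 12 * s ^ 3 - 108/5 * s ^ 5 + 936/35 * s ^ 7 - 384/35 * s ^ 9" and \<psi> =
      "\<lambda>s c. (2 * s - 6 * s ^ 3 + 48/5 * s ^ 5 - 32/7 * s ^ 7)*(18 * s - 24 * s ^ 3)"
      and A' = "\<lambda>s. 36 * s ^ 2 - 108 * s ^ 4 + 936/5 * s ^ 6 - 3456/35 * s ^ 8"])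
    fix s c :: real assume "s\<^sup>2 + c\<^sup>2 = 1"
    then show "c\<^sup>2 * (36 * s ^ 2 - 108 * s ^ 4 + 936/5 * s ^ 6 - 3456/35 * s ^ 8) - s * (12 * s ^ 3 - 108/5 * s
        ^ 5 + 936/35 * s ^ 7 - 384/35 * s ^ 9) = (2 * s - 6 * s ^ 3 + 48/5 * s ^ 5 - 32/7 * s ^ 7)*(18 * s - 24
        * s ^ 3)"
      by algebra
  qed (auto intro!: derivative_eq_intros bdd_add bdd_diff bdd_minus bdd_mult bdd_divide bdd_power)
  have h2: "osc (\<lambda>i t. cn i t * (- 216/5 * sn i t ^ 5 + 1656/35 * sn i t ^ 7 - 576/35 * sn i t ^ 9)) (\<lambda>i t. g4 i
      t * b i t)"
    unfolding g4_def b_def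
  proof (rule osc_poly_cos[where A = "\<lambda>s. - 216/5 * s ^ 5 + 1656/35 * s ^ 7 - 576/35 * s ^ 9" and \<psi> = "\<lambda>s c. (-
      12 * s ^ 3 + 84/5 * s ^ 5 - 48/7 * s ^ 7)*(18 * s - 24 * s ^ 3)"
      and A' = "\<lambda>s. - 216 * s ^ 4 + 1656/5 * s ^ 6 - 5184/35 * s ^ 8"])
    fix s c :: real assume "s\<^sup>2 + c\<^sup>2 = 1"
    then show "c\<^sup>2 * (- 216 * s ^ 4 + 1656/5 * s ^ 6 - 5184/35 * s ^ 8) - s * (- 216/5 * s ^ 5 + 1656/35 * s ^ 7
        - 576/35 * s ^ 9) = (- 12 * s ^ 3 + 84/5 * s ^ 5 - 48/7 * s ^ 7)*(18 * s - 24 * s ^ 3)"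
      by algebra
  qed (auto intro!: derivative_eq_intros bdd_add bdd_diff bdd_minus bdd_mult bdd_divide bdd_power)
  have h3: "osc (\<lambda>i t. 18/5 * sn i t ^ 2 - 6 * sn i t ^ 4 + 22/5 * sn i t ^ 6 - 6/5 * sn i t ^ 8) (\<lambda>i t. g5 i t
      * b i t)"
    unfolding g5_def b_def
  proof (rule osc_poly[where A = "\<lambda>s. 18/5 * s ^ 2 - 6 * s ^ 4 + 22/5 * s ^ 6 - 6/5 * s ^ 8" and \<psi> = "\<lambda>s c. (c *
      (2/5 - 4/5 * s ^ 2 + 2/5 * s ^ 4))*(18 * s - 24 * s ^ 3)"
      and A' = "\<lambda>s. 36/5 * s - 24 * s ^ 3 + 132/5 * s ^ 5 - 48/5 * s ^ 7"])
    fix s c :: real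
    show "c * (36/5 * s - 24 * s ^ 3 + 132/5 * s ^ 5 - 48/5 * s ^ 7) = (c * (2/5 - 4/5 * s ^ 2 + 2/5 * s ^
        4))*(18 * s - 24 * s ^ 3)"
      by algebra
  qed (auto intro!: derivative_eq_intros bdd_add bdd_diff bdd_minus bdd_mult bdd_divide bdd_power)
  have h4: "osc (\<lambda>i t. cn i t * (- 4/3 * sn i t + 16/3 * sn i t ^ 3 - 76/5 * sn i t ^ 5 + 296/15 * sn i t ^ 7 -
      128/15 * sn i t ^ 9)) (\<lambda>i t. g1 i t ^ 3 / 6 * cn i t)"
    unfolding g1_def
  proof (rule osc_poly_cos[where A = "\<lambda>s. - 4/3 * s + 16/3 * s ^ 3 - 76/5 * s ^ 5 + 296/15 * s ^ 7 - 128/15 * s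
      ^ 9" and \<psi> = "\<lambda>s c. (c * (- 2 + 8 * s ^ 2))^ 3 / 6 * c"
      and A' = "\<lambda>s. - 4/3 + 16 * s ^ 2 - 76 * s ^ 4 + 2072/15 * s ^ 6 - 384/5 * s ^ 8"])
    fix s c :: real assume "s\<^sup>2 + c\<^sup>2 = 1"
    then show "c\<^sup>2 * (- 4/3 + 16 * s ^ 2 - 76 * s ^ 4 + 2072/15 * s ^ 6 - 384/5 * s ^ 8) - s * (- 4/3 * s + 16/3
        * s ^ 3 - 76/5 * s ^ 5 + 296/15 * s ^ 7 - 128/15 * s ^ 9) = (c * (- 2 + 8 * s ^ 2))^ 3 / 6 * c"
      by algebra
  qed (auto intro!: derivative_eq_intros bdd_add bdd_diff bdd_minus bdd_mult bdd_divide bdd_power)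
  have h5: "osc (\<lambda>i t. sn i t ^ 2 - 3/2 * sn i t ^ 4 + 8/5 * sn i t ^ 6 - 4/7 * sn i t ^ 8) (\<lambda>i t. g3 i t * cn i t)"
    unfolding g3_def
  proof (rule osc_poly[where A = "\<lambda>s. s ^ 2 - 3/2 * s ^ 4 + 8/5 * s ^ 6 - 4/7 * s ^ 8" and \<psi> = "\<lambda>s c. (2 * s - 6
      * s ^ 3 + 48/5 * s ^ 5 - 32/7 * s ^ 7)* c"
      and A' = "\<lambda>s. 2 * s - 6 * s ^ 3 + 48/5 * s ^ 5 - 32/7 * s ^ 7"])
    fix s c :: real
    show "c * (2 * s - 6 * s ^ 3 + 48/5 * s ^ 5 - 32/7 * s ^ 7) = (2 * s - 6 * s ^ 3 + 48/5 * s ^ 5 - 32/7 * s ^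
        7)* c"
      by algebra
  qed (auto intro!: derivative_eq_intros bdd_add bdd_diff bdd_minus bdd_mult bdd_divide bdd_power)
  have h6: "osc (\<lambda>i t. - 3 * sn i t ^ 4 + 14/5 * sn i t ^ 6 - 6/7 * sn i t ^ 8) (\<lambda>i t. g4 i t * cn i t)"
    unfolding g4_def
  proof (rule osc_poly[where A = "\<lambda>s. - 3 * s ^ 4 + 14/5 * s ^ 6 - 6/7 * s ^ 8" and \<psi> = "\<lambda>s c. (- 12 * s ^ 3 +
      84/5 * s ^ 5 - 48/7 * s ^ 7)* c"
      and A' = "\<lambda>s. - 12 * s ^ 3 + 84/5 * s ^ 5 - 48/7 * s ^ 7"])
    fix s c :: real
    show "c * (- 12 * s ^ 3 + 84/5 * s ^ 5 - 48/7 * s ^ 7) = (- 12 * s ^ 3 + 84/5 * s ^ 5 - 48/7 * s ^ 7)* c"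
      by algebra
  qed (auto intro!: derivative_eq_intros bdd_add bdd_diff bdd_minus bdd_mult bdd_divide bdd_power)
  \<comment> \<open>Since 1 - 2 s^2 + s^4 = c^4, the word \<open>g5 * cn\<close> is 2/5 c^6, and the
    mean of c^6 is 5/16; this gives the subtracted mean 1/8.\<close>
  have h7: "osc (\<lambda>i t. cn i t * (11/40 * sn i t - 13/60 * sn i t ^ 3 + 1/15 * sn i t ^ 5)) (\<lambda>i t. (g5 i t * cn i
      t - 1 / 8))"
    unfolding g5_def
  proof (rule osc_poly_cos[where A = "\<lambda>s. 11/40 * s - 13/60 * s ^ 3 + 1/15 * s ^ 5" and \<psi> = "\<lambda>s c. ((c * (2/5 -
      4/5 * s ^ 2 + 2/5 * s ^ 4))* c - 1 / 8)"
      and A' = "\<lambda>s. 11/40 - 13/20 * s ^ 2 + 1/3 * s ^ 4"])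
    fix s c :: real assume "s\<^sup>2 + c\<^sup>2 = 1"
    then show "c\<^sup>2 * (11/40 - 13/20 * s ^ 2 + 1/3 * s ^ 4) - s * (11/40 * s - 13/60 * s ^ 3 + 1/15 * s ^ 5) =
        ((c * (2/5 - 4/5 * s ^ 2 + 2/5 * s ^ 4))* c - 1 / 8)"
      by algebra
  qed (auto intro!: derivative_eq_intros bdd_add bdd_diff bdd_minus bdd_mult bdd_divide bdd_power)
  note o1b = oscD[OF o1]
  \<comment> \<open>Powers of \<open>g1\<close> integrate the words in which \<open>b\<close> is
    repeated, because \<open>g1\<close> is an antiderivative of \<open>b\<close>.\<close>
  have o1sq: "osc (\<lambda>i t. g1 i t ^ 2 / 2) (\<lambda>i t. g1 i t * b i t)"
    and o1cub: "osc (\<lambda>i t. g1 i t ^ 3 / 6) (\<lambda>i t. g1 i t ^ 2 / 2 * b i t)"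
    and o1four: "osc (\<lambda>i t. g1 i t ^ 4 / 24) (\<lambda>i t. g1 i t ^ 3 / 6 * b i t)"
    unfolding osc_def using o1b(1)
    by (auto intro!: bdd_divide bdd_power derivative_eq_intros o1b(2))
  \<comment> \<open>These are the derivatives along the heading of the slow factors of level three:
    of \<open>j0 * (j1 * j1 + j0 * j2)\<close>, of \<open>j1 * j1 + j0 * j2\<close>, and of
    \<open>j0 * j2\<close>.\<close>
  define L1 where "L1 = (\<lambda>i t. j1 i t ^ 3 + 4 * j0 i t * j1 i t * j2 i t + j0 i t ^ 2 * j3 i t)"
  define L2 where "L2 = (\<lambda>i t. 3 * j1 i t * j2 i t + j0 i t * j3 i t)"
  define L3 where "L3 = (\<lambda>i t. j1 i t * j2 i t + j0 i t * j3 i t)"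
  have s02: "slow (\<lambda>i t. j0 i t * j2 i t) L3"
    by (rule slow_cong[OF slow_mult[OF j01 j23]]) (simp_all add: L3_def)
  have s11: "slow (\<lambda>i t. j1 i t * j1 i t + j0 i t * j2 i t) L2"
    by (rule slow_cong[OF slow_add[OF slow_mult[OF j12 j12] s02]]) (simp_all add: L2_def L3_def)
  have s1: "slow (\<lambda>i t. j0 i t * (j1 i t * j1 i t + j0 i t * j2 i t)) L1"
    by (rule slow_cong[OF slow_mult[OF j01 s11]]) (simp_all add: L1_def L2_def algebra_simps power2_eq_square
        power3_eq_cube)
  have "bdd j0" using j01 by (simp add: slow_def)
  then have bf: "bdd f" unfolding f_def
    by (intro bdd_add bdd_diff bdd_mult bdd_const bdd_osc bdd_power)
  have s03: "slow L3 (\<lambda>i t. j1 i t * j3 i t + j2 i t * j2 i t + (j1 i t * j3 i t + j0 i t * j4 i t))"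
    unfolding L3_def by (rule slow_cong[OF slow_add[OF slow_mult[OF j12 j23] slow_mult[OF j01 j34]]]) simp_all
  \<comment> \<open>At the last level the next derivative along the heading enters only through its
    boundedness, so it can stay anonymous.\<close>
  obtain q2 where sL2: "slow L2 q2"
    using slow_add[OF slow_cmult[OF slow_mult[OF j12 j23], of 3] slow_mult[OF j01 j34]]
    by (auto simp: L2_def mult.assoc)
  obtain q1 where sL1: "slow L1 q1"
    using slow_add[OF slow_add[OF slow_mult[OF j12 slow_mult[OF j12 j12]]
      slow_cmult[OF slow_mult[OF j01 slow_mult[OF j12 j23]], of 4]] slow_mult[OF j01 slow_mult[OF j01 j34]]]
    by (auto simp: L1_def mult.assoc power3_eq_cube power2_eq_square)
  \<comment> \<open>The words starting with \<open>cn\<close> end here: their slow factor is the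
    constant \<open>2 * a\<close>, with derivative 0.\<close>
  have t0: "negl (\<lambda>i t. \<delta> i ^ 1 / \<delta> i ^ 4 * cn i t * (2 * a) + \<delta> i ^ 1 / \<delta> i ^ 3 * sn i t * f i t * 0)"
    by (rule negl_by_parts[OF osc_basic(1) slow_const]) simp
  have t1: "negl (\<lambda>i t. \<delta> i ^ 1 / \<delta> i ^ 4 * b i t * (k * j0 i t) + \<delta> i ^ 1 / \<delta> i ^ 3 * g1 i t * f i t * (k * j1 i t))"
    by (rule negl_by_parts[OF o1 slow_cmult[OF j01]]) simp
  \<comment> \<open>From here on, each slow factor is minus the one left by the previous remainder,
    times \<open>k * j0\<close> for the letter \<open>b\<close> and times \<open>2 * a\<close> for
    the letter \<open>cn\<close>.\<close>
  have t2: "negl (\<lambda>i t. \<delta> i ^ 2 / \<delta> i ^ 4 * (g1 i t * b i t) * (- (k ^ 2) * (j0 i t * j1 i t)) +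
      \<delta> i ^ 2 / \<delta> i ^ 3 * (g1 i t ^ 2 / 2) * f i t * (- (k ^ 2) * (j1 i t * j1 i t + j0 i t * j2 i t)))"
    by (rule negl_by_parts[OF o1sq slow_cmult[OF slow_mult[OF j01 j12]]]) simp
  have t3: "negl (\<lambda>i t. \<delta> i ^ 2 / \<delta> i ^ 4 * (g1 i t * cn i t) * (- 2 * a * k * j1 i t) +
      \<delta> i ^ 2 / \<delta> i ^ 3 * g2 i t * f i t * (- 2 * a * k * j2 i t))"
    by (rule negl_by_parts[OF o2 slow_cmult[OF j12]]) simp
  have t4: "negl (\<lambda>i t. \<delta> i ^ 3 / \<delta> i ^ 4 * (g1 i t ^ 2 / 2 * b i t) * (k ^ 3 * (j0 i t * (j1 i t * j1 i t + j0
      i t * j2 i t))) +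
      \<delta> i ^ 3 / \<delta> i ^ 3 * (g1 i t ^ 3 / 6) * f i t * (k ^ 3 * L1 i t))"
    by (rule negl_by_parts[OF o1cub slow_cmult[OF s1]]) simp
  have t5: "negl (\<lambda>i t. \<delta> i ^ 3 / \<delta> i ^ 4 * (g1 i t ^ 2 / 2 * cn i t) * (2 * a * k ^ 2 * (j1 i t * j1 i t + j0 i
      t * j2 i t)) +
      \<delta> i ^ 3 / \<delta> i ^ 3 * g3 i t * f i t * (2 * a * k ^ 2 * L2 i t))"
    by (rule negl_by_parts[OF o3 slow_cmult[OF s11]]) simp
  have t6: "negl (\<lambda>i t. \<delta> i ^ 3 / \<delta> i ^ 4 * (g2 i t * b i t) * (2 * a * k ^ 2 * (j0 i t * j2 i t)) +
      \<delta> i ^ 3 / \<delta> i ^ 3 * g4 i t * f i t * (2 * a * k ^ 2 * L3 i t))"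
    by (rule negl_by_parts[OF o4 slow_cmult[OF s02]]) simp
  have t7: "negl (\<lambda>i t. \<delta> i ^ 3 / \<delta> i ^ 4 * (g2 i t * cn i t) * (4 * a ^ 2 * k * j2 i t) +
      \<delta> i ^ 3 / \<delta> i ^ 3 * g5 i t * f i t * (4 * a ^ 2 * k * j3 i t))"
    by (rule negl_by_parts[OF o5 slow_cmult[OF j23]]) simp
  have t8: "negl (\<lambda>i t. g1 i t ^ 3 / 6 * b i t * (- (k ^ 4) * (j0 i t * L1 i t)))"
    by (rule negl_by_parts_last[OF o1four slow_cmult[OF slow_mult[OF j01 sL1]] bf])
  have t9: "negl (\<lambda>i t. g1 i t ^ 3 / 6 * cn i t * (- 2 * a * k ^ 3 * L1 i t))"
    by (rule negl_by_parts_last[OF h4 slow_cmult[OF sL1] bf])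
  have t10: "negl (\<lambda>i t. g3 i t * b i t * (- 2 * a * k ^ 3 * (j0 i t * L2 i t)))"
    by (rule negl_by_parts_last[OF h1 slow_cmult[OF slow_mult[OF j01 sL2]] bf])
  have t11: "negl (\<lambda>i t. g3 i t * cn i t * (- 4 * a ^ 2 * k ^ 2 * L2 i t))"
    by (rule negl_by_parts_last[OF h5 slow_cmult[OF sL2] bf])
  have t12: "negl (\<lambda>i t. g4 i t * b i t * (- 2 * a * k ^ 3 * (j0 i t * L3 i t)))"
    by (rule negl_by_parts_last[OF h2 slow_cmult[OF slow_mult[OF j01 s03]] bf])
  have t13: "negl (\<lambda>i t. g4 i t * cn i t * (- 4 * a ^ 2 * k ^ 2 * L3 i t))"
    by (rule negl_by_parts_last[OF h6 slow_cmult[OF s03] bf])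
  have t14: "negl (\<lambda>i t. g5 i t * b i t * (- 4 * a ^ 2 * k ^ 2 * (j0 i t * j3 i t)))"
    by (rule negl_by_parts_last[OF h3 slow_cmult[OF slow_mult[OF j01 j34]] bf])
  \<comment> \<open>Subtracting the mean adds \<open>a ^ 3 * k * j3 i t\<close> to the word; this is
    the averaged term of the conclusion.\<close>
  have t15: "negl (\<lambda>i t. (g5 i t * cn i t - 1 / 8) * (- 8 * a ^ 3 * k * j3 i t))"
    by (rule negl_by_parts_last[OF h7 slow_cmult[OF j34] bf])
  show ?thesis
  proof (rule negl_cong[OF negl_add[OF negl_add[OF negl_add[OF negl_add[OF t0 t1] negl_add[OF t2 t3]]
      negl_add[OF negl_add[OF t4 t5] negl_add[OF t6 t7]]]
      negl_add[OF negl_add[OF negl_add[OF t8 t9] negl_add[OF t10 t11]] negl_add[OF negl_add[OF t12 t13]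
          negl_add[OF t14 t15]]]]])
    fix i t assume "i \<in> I"
    then have d: "\<delta> i \<noteq> 0" using \<delta>_bounds by force
    \<comment> \<open>In powers of \<open>u\<close> the claim splits into one identity per level.
      \<open>l1\<close> says that level one is \<open>f\<close> itself; \<open>l2\<close>,
      \<open>l3\<close>, \<open>l4\<close> say that the remainders of a level cancel the words of
      the next one; \<open>l5\<close> isolates the mean.\<close>
    define u where "u = 1 / \<delta> i"
    have pw: "\<delta> i ^ 1 / \<delta> i ^ 4 = u ^ 3" "\<delta> i ^ 1 / \<delta> i ^ 3 = u ^ 2" "\<delta> i ^ 2 / \<delta> i ^ 4 = u ^ 2"
      "\<delta> i ^ 2 / \<delta> i ^ 3 = u" "\<delta> i ^ 3 / \<delta> i ^ 4 = u" "\<delta> i ^ 3 / \<delta> i ^ 3 = 1"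
      "f i t / \<delta> i ^ 3 = f i t * u ^ 3"
      using d by (simp_all add: u_def field_simps eval_nat_numeral)
    have F: "f i t = k * j0 i t * b i t + 2 * a * cn i t"
      by (simp add: f_def b_def)
    let ?F = "f i t" and ?B = "b i t" and ?C = "cn i t"
    have l4: "g1 i t ^ 3 / 6 * ?F * (k ^ 3 * L1 i t) + g3 i t * ?F * (2 * a * k ^ 2 * L2 i t) +
        (g4 i t * ?F * (2 * a * k ^ 2 * L3 i t) + g5 i t * ?F * (4 * a ^ 2 * k * j3 i t))
      = - (g1 i t ^ 3 / 6 * ?B * (- (k ^ 4) * (j0 i t * L1 i t)) + g1 i t ^ 3 / 6 * ?C * (- 2 * a * k ^ 3 * L1 i t)
        + (g3 i t * ?B * (- 2 * a * k ^ 3 * (j0 i t * L2 i t)) + g3 i t * ?C * (- 4 * a ^ 2 * k ^ 2 * L2 i t))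
        + (g4 i t * ?B * (- 2 * a * k ^ 3 * (j0 i t * L3 i t)) + g4 i t * ?C * (- 4 * a ^ 2 * k ^ 2 * L3 i t)
        + (g5 i t * ?B * (- 4 * a ^ 2 * k ^ 2 * (j0 i t * j3 i t)) + g5 i t * ?C * (- 8 * a ^ 3 * k * j3 i t))))"
      unfolding F by (simp add: algebra_simps eval_nat_numeral)
    have l3: "u * (g1 i t ^ 2 / 2) * ?F * (- (k ^ 2) * (j1 i t * j1 i t + j0 i t * j2 i t)) + u * g2 i t * ?F *
        (- 2 * a * k * j2 i t)
      = - (u * (g1 i t ^ 2 / 2 * ?B) * (k ^ 3 * (j0 i t * (j1 i t * j1 i t + j0 i t * j2 i t)))
        + u * (g1 i t ^ 2 / 2 * ?C) * (2 * a * k ^ 2 * (j1 i t * j1 i t + j0 i t * j2 i t))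
        + (u * (g2 i t * ?B) * (2 * a * k ^ 2 * (j0 i t * j2 i t)) + u * (g2 i t * ?C) * (4 * a ^ 2 * k * j2 i t)))"
      unfolding F by (simp add: algebra_simps eval_nat_numeral)
    have l2: "u ^ 2 * g1 i t * ?F * (k * j1 i t)
      = - (u ^ 2 * (g1 i t * ?B) * (- (k ^ 2) * (j0 i t * j1 i t)) + u ^ 2 * (g1 i t * ?C) * (- 2 * a * k * j1 i t))"
      unfolding F by (simp add: algebra_simps eval_nat_numeral)
    have l1: "u ^ 3 * ?C * (2 * a) + u ^ 3 * ?B * (k * j0 i t) = ?F * u ^ 3"
      unfolding F by (simp add: algebra_simps eval_nat_numeral)
    have l5: "(g5 i t * ?C - 1 / 8) * (- 8 * a ^ 3 * k * j3 i t) = g5 i t * ?C * (- 8 * a ^ 3 * k * j3 i t) + a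
        ^ 3 * k * j3 i t"
      by (simp add: algebra_simps)
    show "(\<delta> i ^ 1 / \<delta> i ^ 4 * cn i t * (2 * a) + \<delta> i ^ 1 / \<delta> i ^ 3 * sn i t * f i t * 0 + (\<delta> i ^ 1 / \<delta> i ^ 4 *
        b i t * (k * j0 i t) + \<delta> i ^ 1 / \<delta> i ^ 3 * g1 i t * f i t * (k * j1 i t))) + ((\<delta> i ^ 2 / \<delta> i ^ 4 * (g1 i
        t * b i t) * (- (k ^ 2) * (j0 i t * j1 i t)) + \<delta> i ^ 2 / \<delta> i ^ 3 * (g1 i t ^ 2 / 2) * f i t * (- (k ^ 2)
        * (j1 i t * j1 i t + j0 i t * j2 i t))) + (\<delta> i ^ 2 / \<delta> i ^ 4 * (g1 i t * cn i t) * (- 2 * a * k * j1 i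
        t) + \<delta> i ^ 2 / \<delta> i ^ 3 * g2 i t * f i t * (- 2 * a * k * j2 i t))) + (((\<delta> i ^ 3 / \<delta> i ^ 4 * (g1 i t ^ 2
        / 2 * b i t) * (k ^ 3 * (j0 i t * (j1 i t * j1 i t + j0 i t * j2 i t))) + \<delta> i ^ 3 / \<delta> i ^ 3 * (g1 i t ^
        3 / 6) * f i t * (k ^ 3 * L1 i t)) + (\<delta> i ^ 3 / \<delta> i ^ 4 * (g1 i t ^ 2 / 2 * cn i t) * (2 * a * k ^ 2 *
        (j1 i t * j1 i t + j0 i t * j2 i t)) + \<delta> i ^ 3 / \<delta> i ^ 3 * g3 i t * f i t * (2 * a * k ^ 2 * L2 i t))) +
        ((\<delta> i ^ 3 / \<delta> i ^ 4 * (g2 i t * b i t) * (2 * a * k ^ 2 * (j0 i t * j2 i t)) + \<delta> i ^ 3 / \<delta> i ^ 3 * g4 i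
        t * f i t * (2 * a * k ^ 2 * L3 i t)) + (\<delta> i ^ 3 / \<delta> i ^ 4 * (g2 i t * cn i t) * (4 * a ^ 2 * k * j2 i
        t) + \<delta> i ^ 3 / \<delta> i ^ 3 * g5 i t * f i t * (4 * a ^ 2 * k * j3 i t)))) + (((g1 i t ^ 3 / 6 * b i t * (-
        (k ^ 4) * (j0 i t * L1 i t)) + g1 i t ^ 3 / 6 * cn i t * (- 2 * a * k ^ 3 * L1 i t)) + (g3 i t * b i t *
        (- 2 * a * k ^ 3 * (j0 i t * L2 i t)) + g3 i t * cn i t * (- 4 * a ^ 2 * k ^ 2 * L2 i t))) + ((g4 i t *
        b i t * (- 2 * a * k ^ 3 * (j0 i t * L3 i t)) + g4 i t * cn i t * (- 4 * a ^ 2 * k ^ 2 * L3 i t)) + (g5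
        i t * b i t * (- 4 * a ^ 2 * k ^ 2 * (j0 i t * j3 i t)) + (g5 i t * cn i t - 1 / 8) * (- 8 * a ^ 3 * k *
        j3 i t)))) = f i t / \<delta> i ^ 3 + a ^ 3 * k * j3 i t"
      unfolding pw l5 using l1 l2 l3 l4 by linarith
  qed
qed

end

section \<open>A strict Lyapunov function for the averaged system\<close>

text \<open>For n > 1 the root is not differentiable at 0, but the difference quotient of the
  product there is \<open>root n h\<close>, which tends to 0. This makes \<open>V\<close> and
  \<open>V * sqrt V\<close> differentiable also where a coordinate or \<open>V\<close>
  vanishes.\<close>

lemma DERIV_mult_root:
  assumes "odd n \<or> n = 2 \<and> 0 \<le> x"
  shows "((\<lambda>x. x * root n x) has_real_derivative (1 + 1 / real n) * root n x) (at x)"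
proof (cases "x = 0")
  case True
  have "((\<lambda>h. (0 + h) * root n (0 + h) / h) \<longlongrightarrow> root n 0) (at 0)"
  proof (rule tendsto_cong[THEN iffD2])
    show "eventually (\<lambda>h. (0 + h) * root n (0 + h) / h = root n h) (at 0)"
      by (auto simp: eventually_at intro: zero_less_one)
    show "(root n \<longlongrightarrow> root n 0) (at 0)"
      by (intro tendsto_intros)
  qed
  then show ?thesis using True by (simp add: DERIV_def)
next
  case False
  have n: "0 < n" using assms by (auto intro: odd_pos)
  have r: "root n x \<noteq> 0" using n False by simp
  have pow: "root n x ^ n = x"
    using assms by (auto simp: odd_real_root_pow)
  have "(root n has_real_derivative inverse (real n * root n x ^ (n - Suc 0))) (at x)"
    using n False assms by (intro DERIV_real_root_generic) auto
  then have "((\<lambda>x. x * root n x) has_real_derivative 1 * root n x + inverse (real n * root n x ^ (n - Suc 0)) *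
      x) (at x)"
    by (intro DERIV_mult DERIV_ident)
  moreover have "inverse (real n * root n x ^ (n - Suc 0)) * x = root n x / real n"
  proof -
    have "x = root n x * root n x ^ (n - Suc 0)"
      using n pow by (metis One_nat_def power_minus_mult mult.commute)
    then show ?thesis using r n by (simp add: field_simps)
  qed
  ultimately show ?thesis by (simp add: algebra_simps)
qed

locale quartic_flow =
  fixes C1 C2 K \<Omega> :: real
  assumes C1: "0 < C1" and C2: "0 < C2" and K: "0 < K" and \<Omega>: "\<Omega> \<noteq> 0"
begin

text \<open>Up to the factor 4/3, \<open>gx\<close> and \<open>gy\<close> are the partial
  derivatives of \<open>V\<close>. The real cube root keeps the sign of its argument, so their cubes
  are \<open>C1 * x\<close> and \<open>C2 * y\<close>.\<close>

definition gx :: "real \<Rightarrow> real" where "gx x = root 3 C1 * root 3 x"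
definition gy :: "real \<Rightarrow> real" where "gy y = root 3 C2 * root 3 y"
definition V :: "real \<Rightarrow> real \<Rightarrow> real" where "V x y = x * gx x + y * gy y"
definition N :: "real \<Rightarrow> real \<Rightarrow> real" where "N x y = (C1 * x)\<^sup>2 + (C2 * y)\<^sup>2"
definition \<xi> :: "real \<Rightarrow> real \<Rightarrow> real \<Rightarrow> real" where
  "\<xi> t x y = C1 * x * cos (\<Omega> * t) ^ 3 + C2 * y * sin (\<Omega> * t) ^ 3"

text \<open>Periodic antiderivatives of cos^6 - 5/16, cos^3 sin^3 and sin^6 - 5/16; the subtracted
  5/16 is the mean of cos^6 and of sin^6.\<close>

definition p1 :: "real \<Rightarrow> real" where
  "p1 \<theta> = cos \<theta> * sin \<theta> * (cos \<theta> ^ 4 / 6 + 5 / 24 * cos \<theta> ^ 2 + 5 / 16)"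
definition p2 :: "real \<Rightarrow> real" where "p2 \<theta> = sin \<theta> ^ 4 / 4 - sin \<theta> ^ 6 / 6"
definition p3 :: "real \<Rightarrow> real" where
  "p3 \<theta> = - cos \<theta> * sin \<theta> * (sin \<theta> ^ 4 / 6 + 5 / 24 * sin \<theta> ^ 2 + 5 / 16)"

text \<open>For fixed x and y the time derivative is \<xi>^2 minus \<open>5 / 16 * N x y\<close>,
  its mean over the heading. Dividing by \<Omega> compensates the inner derivative, so a turning
  heading is essential here.\<close>

definition \<Psi> :: "real \<Rightarrow> real \<Rightarrow> real \<Rightarrow> real" where
  "\<Psi> t x y = ((C1 * x)\<^sup>2 * p1 (\<Omega> * t) + 2 * (C1 * x) * (C2 * y) * p2 (\<Omega> * t) + (C2 * y)\<^sup>2 * p3 (\<Omega> * t)) / \<Omega>"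

section \<open>Size of \<open>V\<close> and descent along the averaged flow\<close>

lemma gx3: "gx x ^ 3 = C1 * x" and gy3: "gy y ^ 3 = C2 * y"
  by (simp_all add: gx_def gy_def power_mult_distrib odd_real_root_pow)

lemma V_eq: "V x y = gx x ^ 4 / C1 + gy y ^ 4 / C2"
proof -
  have "x = gx x ^ 3 / C1" "y = gy y ^ 3 / C2"
    using C1 C2 by (simp_all add: gx3 gy3)
  then have "V x y = gx x ^ 3 / C1 * gx x + gy y ^ 3 / C2 * gy y"
    unfolding V_def by metis
  then show ?thesis by (simp add: eval_nat_numeral mult_ac)
qed

lemma N_eq: "N x y = gx x ^ 6 + gy y ^ 6"
  unfolding N_def gx3[symmetric] gy3[symmetric] by simp

lemma V_nonneg: "0 \<le> V x y"
  unfolding V_eq using C1 C2 by simp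

text \<open>The constants compare \<open>sqrt V\<close> with \<open>gx^2 + gy^2\<close>. The lower
  one, \<kappa>, comes from (u + v)^2 \<le> 2 (u^2 + v^2) and from bounding both coefficients by
  \<open>C1 + C2\<close>; the upper one, \<nu>, from u^4 + v^4 \<le> (u^2 + v^2)^2 and from bounding
  both reciprocals by their sum.\<close>

definition \<kappa> :: real where "\<kappa> = 1 / sqrt (2 * (C1 + C2))"
definition \<nu> :: real where "\<nu> = sqrt (1 / C1 + 1 / C2)"

lemma \<kappa>_pos: "0 < \<kappa>" and \<nu>_pos: "0 < \<nu>"
  using C1 C2 by (simp_all add: \<kappa>_def \<nu>_def add_pos_pos)

lemma sqrt_V_ge: "\<kappa> * (gx x ^ 2 + gy y ^ 2) \<le> sqrt (V x y)"
proof (rule real_le_rsqrt)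
  have le: "u / (C1 + C2) \<le> u / C1" "u / (C1 + C2) \<le> u / C2" if "0 \<le> u" for u
    using C1 C2 that by (simp_all add: frac_le)
  have "(\<kappa> * (gx x ^ 2 + gy y ^ 2))\<^sup>2 = (gx x ^ 2 + gy y ^ 2)\<^sup>2 / (2 * (C1 + C2))"
    using C1 C2 by (simp add: \<kappa>_def power_divide power_mult_distrib)
  also have "\<dots> \<le> (2 * (gx x ^ 4 + gy y ^ 4)) / (2 * (C1 + C2))"
  proof (rule divide_right_mono)
    show "((gx x)\<^sup>2 + (gy y)\<^sup>2)\<^sup>2 \<le> 2 * (gx x ^ 4 + gy y ^ 4)"
      using zero_le_power2[of "gx x ^ 2 - gy y ^ 2"] by (simp add: power2_eq_square eval_nat_numeral algebra_simps)
  qed (use C1 C2 in simp)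
  also have "\<dots> = gx x ^ 4 / (C1 + C2) + gy y ^ 4 / (C1 + C2)"
    using C1 C2 by (simp only: mult_divide_mult_cancel_left_if add_divide_distrib) simp
  also have "\<dots> \<le> V x y"
    unfolding V_eq by (intro add_mono le) auto
  finally show "(\<kappa> * (gx x ^ 2 + gy y ^ 2))\<^sup>2 \<le> V x y" .
qed

lemma sqrt_V_le: "sqrt (V x y) \<le> \<nu> * (gx x ^ 2 + gy y ^ 2)"
proof (rule real_le_lsqrt)
  have "V x y \<le> (gx x ^ 4 + gy y ^ 4) / C1 + (gx x ^ 4 + gy y ^ 4) / C2"
    unfolding V_eq using C1 C2 by (intro add_mono divide_right_mono) auto
  also have "\<dots> = (1 / C1 + 1 / C2) * (gx x ^ 4 + gy y ^ 4)"
    by (simp add: ring_distribs add_divide_distrib)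
  also have "\<dots> \<le> (1 / C1 + 1 / C2) * (gx x ^ 2 + gy y ^ 2)\<^sup>2"
    using C1 C2 by (intro mult_left_mono) (auto simp: power2_sum)
  also have "\<dots> = (\<nu> * (gx x ^ 2 + gy y ^ 2))\<^sup>2"
    using C1 C2 by (simp add: \<nu>_def power_mult_distrib)
  finally show "V x y \<le> (\<nu> * (gx x ^ 2 + gy y ^ 2))\<^sup>2" .
qed (use \<nu>_pos in auto)

text \<open>With u = gx^2 and v = gy^2, \<open>sqrt V\<close> is comparable to u + v, while
  \<open>N\<close> is u^3 + v^3, and u^3 + v^3 \<le> (u + v)^3 \<le> 4 (u^3 + v^3).\<close>

lemma V32_bounds: "\<kappa> ^ 3 * N x y \<le> V x y * sqrt (V x y)" "V x y * sqrt (V x y) \<le> 4 * \<nu> ^ 3 * N x y"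
proof -
  have eq: "V x y * sqrt (V x y) = sqrt (V x y) ^ 3"
    using V_nonneg by (simp add: power3_eq_cube)
  define u v where "u = gx x ^ 2" and "v = gy y ^ 2"
  have nn: "0 \<le> u" "0 \<le> v" by (simp_all add: u_def v_def)
  have Nuv: "N x y = u ^ 3 + v ^ 3"
    by (simp add: N_eq u_def v_def)
  have "\<kappa> ^ 3 * N x y \<le> \<kappa> ^ 3 * (u + v) ^ 3"
    using nn \<kappa>_pos unfolding Nuv
    by (intro mult_left_mono) (auto simp: eval_nat_numeral algebra_simps)
  also have "\<dots> \<le> sqrt (V x y) ^ 3"
    using sqrt_V_ge[of x y] \<kappa>_pos nn unfolding power_mult_distrib[symmetric] u_def v_def
    by (intro power_mono) auto
  finally show "\<kappa> ^ 3 * N x y \<le> V x y * sqrt (V x y)" unfolding eq .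
  have "sqrt (V x y) ^ 3 \<le> (\<nu> * (u + v)) ^ 3"
    using sqrt_V_le[of x y] V_nonneg unfolding u_def v_def by (intro power_mono) auto
  also have "\<dots> \<le> \<nu> ^ 3 * (4 * (u ^ 3 + v ^ 3))"
    unfolding power_mult_distrib
  proof (rule mult_left_mono)
    have "0 \<le> 3 * (u + v) * (u - v)\<^sup>2" using nn by simp
    also have "\<dots> = 4 * (u ^ 3 + v ^ 3) - (u + v) ^ 3" by algebra
    finally show "(u + v) ^ 3 \<le> 4 * (u ^ 3 + v ^ 3)" by simp
  qed (use \<nu>_pos in simp)
  finally show "V x y * sqrt (V x y) \<le> 4 * \<nu> ^ 3 * N x y" unfolding eq Nuv by (simp add: algebra_simps)
qed

text \<open>With \<open>A = gx x * cos \<theta>\<close> and \<open>B = gy y * sin \<theta>\<close> one has \<open>\<xi> = A\<^sup>3 + B\<^sup>3 = (A + B) (A\<^sup>2 - A B + B\<^sup>2)\<close>,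
  which is why the exponent \<open>4/3\<close> in \<open>V\<close> makes the flow direction a descent direction for every heading.\<close>

lemma descent:
  "2 * \<kappa> / 3 * (\<xi> t x y)\<^sup>2 \<le> sqrt (V x y) * (gx x * cos (\<Omega> * t) + gy y * sin (\<Omega> * t)) * \<xi> t x y"
proof -
  define A B where "A = gx x * cos (\<Omega> * t)" and "B = gy y * sin (\<Omega> * t)"
  define E where "E = A\<^sup>2 - A * B + B\<^sup>2"
  have \<xi>: "\<xi> t x y = (A + B) * E"
    unfolding \<xi>_def gx3[symmetric] gy3[symmetric] A_def B_def E_def by algebra
  have E0: "0 \<le> E"
    using sum_power2_ge_zero[of A B] zero_le_power2[of "A - B"]
    unfolding E_def power2_diff by linarith
  have "cos (\<Omega> * t) ^ 2 \<le> 1" "sin (\<Omega> * t) ^ 2 \<le> 1"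
    by (simp_all add: abs_square_le_1)
  then have "A\<^sup>2 + B\<^sup>2 \<le> gx x ^ 2 + gy y ^ 2"
    unfolding A_def B_def power_mult_distrib by (intro add_mono mult_left_le) auto
  moreover have "E \<le> 3 / 2 * (A\<^sup>2 + B\<^sup>2)"
    using zero_le_power2[of "A + B"] by (simp add: E_def power2_eq_square algebra_simps)
  ultimately have "2 / 3 * E \<le> gx x ^ 2 + gy y ^ 2" by simp
  \<comment> \<open>As \<xi>^2 = (A + B)^2 E^2, bounding just one factor \<open>E\<close> by
    \<open>sqrt V\<close> leaves exactly (A + B) \<xi> on the right.\<close>
  then have "\<kappa> * (2 / 3 * E) \<le> sqrt (V x y)"
    using \<kappa>_pos by (intro order_trans[OF mult_left_mono sqrt_V_ge]) auto
  then have "\<kappa> * (2 / 3 * E) * ((A + B)\<^sup>2 * E) \<le> sqrt (V x y) * ((A + B)\<^sup>2 * E)"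
    using E0 by (intro mult_right_mono) auto
  then show ?thesis
    unfolding A_def[symmetric] B_def[symmetric] \<xi> by (simp add: power2_eq_square algebra_simps)
qed

text \<open>The factor 2 is 3/2, from the outer power, times 4/3, from \<open>V\<close>.\<close>

lemma DERIV_V32:
  assumes "(x has_real_derivative x') (at t within T)" "(y has_real_derivative y') (at t within T)"
  shows "((\<lambda>t. V (x t) (y t) * sqrt (V (x t) (y t))) has_real_derivative
     2 * sqrt (V (x t) (y t)) * (gx (x t) * x' + gy (y t) * y')) (at t within T)"
proof -
  have d3: "((\<lambda>x. x * root 3 x) has_real_derivative (1 + 1 / real 3) * root 3 x) (at x)" for x
    by (rule DERIV_mult_root) simp
  have d2: "((\<lambda>v. v * sqrt v) has_real_derivative (1 + 1 / real 2) * sqrt v) (at v)" if "0 \<le> v" for v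
    unfolding sqrt_def by (rule DERIV_mult_root) (use that in simp)
  have Vr: "V u v = root 3 C1 * (u * root 3 u) + root 3 C2 * (v * root 3 v)" for u v
    by (simp add: V_def gx_def gy_def)
  have "((\<lambda>t. V (x t) (y t)) has_real_derivative
    root 3 C1 * ((1 + 1 / real 3) * root 3 (x t) * x') + root 3 C2 * ((1 + 1 / real 3) * root 3 (y t) * y')) (at
        t within T)"
    unfolding Vr by (intro DERIV_add DERIV_cmult DERIV_chain2[OF d3] assms)
  then show ?thesis
    by (rule DERIV_cong[OF DERIV_chain2[where g = "\<lambda>t. V (x t) (y t)", OF d2[OF V_nonneg]]]) (simp add: gx_def
        gy_def algebra_simps)
qed

section \<open>The periodic quadratic form \<Psi>\<close>

lemma DERIV_p:
  "(p1 has_real_derivative cos \<theta> ^ 6 - 5 / 16) (at \<theta>)"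
  "(p2 has_real_derivative cos \<theta> ^ 3 * sin \<theta> ^ 3) (at \<theta>)"
  "(p3 has_real_derivative sin \<theta> ^ 6 - 5 / 16) (at \<theta>)"
proof -
  have sc: "sin \<theta> ^ 2 + cos \<theta> ^ 2 = 1" by simp
  show "(p1 has_real_derivative cos \<theta> ^ 6 - 5 / 16) (at \<theta>)"
    unfolding p1_def
    by (rule derivative_eq_intros refl | simp)+ (use sc in algebra)
  show "(p2 has_real_derivative cos \<theta> ^ 3 * sin \<theta> ^ 3) (at \<theta>)"
    unfolding p2_def
    by (rule derivative_eq_intros refl | simp)+ (use sc in algebra)
  show "(p3 has_real_derivative sin \<theta> ^ 6 - 5 / 16) (at \<theta>)"
    unfolding p3_def
    by (rule derivative_eq_intros refl | simp)+ (use sc in algebra)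
qed

lemma p_bounds: "\<bar>p1 \<theta>\<bar> \<le> 1" "\<bar>p2 \<theta>\<bar> \<le> 1" "\<bar>p3 \<theta>\<bar> \<le> 1"
proof -
  have pw: "\<bar>u\<bar> ^ n \<le> 1" "0 \<le> \<bar>u\<bar> ^ n" if "\<bar>u\<bar> \<le> 1" for u :: real and n
    using that by (auto simp: power_le_one)
  have b: "\<bar>c * s * (w ^ 4 / 6 + 5 / 24 * w ^ 2 + 5 / 16)\<bar> \<le> 1"
    if "\<bar>c\<bar> \<le> 1" "\<bar>s\<bar> \<le> 1" "\<bar>w\<bar> \<le> 1" for c s w :: real
  proof -
    have "\<bar>w ^ 4 / 6 + 5 / 24 * w ^ 2 + 5 / 16\<bar> \<le> 1"
      using pw[OF that(3), of 4] pw[OF that(3), of 2] by simp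
    moreover have "\<bar>c * s\<bar> \<le> 1"
      using that by (simp add: abs_mult mult_le_one)
    ultimately show ?thesis by (simp only: abs_mult[of "c * s"] mult_le_one abs_ge_zero)
  qed
  show "\<bar>p1 \<theta>\<bar> \<le> 1" unfolding p1_def by (rule b) auto
  show "\<bar>p3 \<theta>\<bar> \<le> 1" unfolding p3_def by (rule b) auto
  have "0 \<le> sin \<theta> ^ 4" "sin \<theta> ^ 4 \<le> 1" "0 \<le> sin \<theta> ^ 6" "sin \<theta> ^ 6 \<le> 1"
    using pw[of "sin \<theta>" 4] pw[of "sin \<theta>" 6] by auto
  then show "\<bar>p2 \<theta>\<bar> \<le> 1" unfolding p2_def by linarith
qed

lemma abs_\<Psi>_le: "\<bar>\<Psi> t x y\<bar> \<le> 2 / \<bar>\<Omega>\<bar> * N x y"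
proof -
  define X Y where "X = C1 * x" and "Y = C2 * y"
  have "\<bar>X\<^sup>2 * p1 (\<Omega> * t) + 2 * X * Y * p2 (\<Omega> * t) + Y\<^sup>2 * p3 (\<Omega> * t)\<bar>
    \<le> \<bar>X\<^sup>2 * p1 (\<Omega> * t)\<bar> + \<bar>2 * X * Y * p2 (\<Omega> * t)\<bar> + \<bar>Y\<^sup>2 * p3 (\<Omega> * t)\<bar>" by linarith
  also have "\<dots> \<le> X\<^sup>2 + \<bar>2 * X * Y\<bar> + Y\<^sup>2"
    unfolding abs_mult[of _ "p1 _"] abs_mult[of _ "p2 _"] abs_mult[of _ "p3 _"]
    by (intro add_mono order_trans[OF mult_left_le[OF p_bounds(1)]]
      order_trans[OF mult_left_le[OF p_bounds(2)]] order_trans[OF mult_left_le[OF p_bounds(3)]]) auto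
  also have "\<dots> \<le> 2 * (X\<^sup>2 + Y\<^sup>2)"
    using zero_le_power2[of "\<bar>X\<bar> - \<bar>Y\<bar>"] by (simp add: power2_diff abs_mult)
  finally show ?thesis
    unfolding \<Psi>_def N_def X_def[symmetric] Y_def[symmetric]
    by (simp add: abs_divide divide_right_mono)
qed

lemma DERIV_\<Psi>:
  assumes "(x has_real_derivative x') (at t within T)" "(y has_real_derivative y') (at t within T)"
  shows "((\<lambda>t. \<Psi> t (x t) (y t)) has_real_derivative
     (\<xi> t (x t) (y t))\<^sup>2 - 5 / 16 * N (x t) (y t) +
     2 / \<Omega> * (x' * C1 * (C1 * x t * p1 (\<Omega> * t) + C2 * y t * p2 (\<Omega> * t)) +
              y' * C2 * (C1 * x t * p2 (\<Omega> * t) + C2 * y t * p3 (\<Omega> * t)))) (at t within T)"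
proof -
  have \<theta>: "((\<lambda>t. \<Omega> * t) has_real_derivative \<Omega> * 1) (at t within T)"
    by (intro DERIV_cmult DERIV_ident)
  note p = DERIV_chain2[OF DERIV_p(1) \<theta>] DERIV_chain2[OF DERIV_p(2) \<theta>] DERIV_chain2[OF DERIV_p(3) \<theta>]
  have X: "((\<lambda>t. C1 * x t) has_real_derivative C1 * x') (at t within T)"
    and Y: "((\<lambda>t. C2 * y t) has_real_derivative C2 * y') (at t within T)"
    using assms by (auto intro: DERIV_cmult)
  show ?thesis
    unfolding \<Psi>_def
    by (rule DERIV_cong[OF DERIV_cdivide[OF DERIV_add[OF DERIV_add[OF DERIV_mult[OF DERIV_power[OF X] p(1)]
        DERIV_mult[OF DERIV_mult[OF DERIV_cmult[OF X] Y] p(2)]] DERIV_mult[OF DERIV_power[OF Y] p(3)]]]])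
      (use \<Omega> in \<open>simp add: field_simps N_def \<xi>_def power2_eq_square eval_nat_numeral\<close>)
qed

text \<open>Decrease of \<open>U\<close> along any curve that follows the averaged system up to
  errors r1, r2 at the single time t. Quantifying over curves avoids partial derivatives of
  \<open>U\<close>. The errors act through the gradient of \<open>U\<close>, so \<open>b\<close>
  depends on the size \<open>M\<close>; the rate \<open>l\<close> must not.\<close>

definition dissipative :: "(real \<Rightarrow> real \<Rightarrow> real \<Rightarrow> real) \<Rightarrow> real \<Rightarrow> real \<Rightarrow> real \<Rightarrow> bool" where
  "dissipative U l M b \<longleftrightarrow> (\<forall>x y t T r1 r2. \<bar>x t\<bar> \<le> M \<longrightarrow> \<bar>y t\<bar> \<le> M \<longrightarrow>
      (x has_real_derivative - K * \<xi> t (x t) (y t) * cos (\<Omega> * t) + r1) (at t within T) \<longrightarrow>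
      (y has_real_derivative - K * \<xi> t (x t) (y t) * sin (\<Omega> * t) + r2) (at t within T) \<longrightarrow>
      (\<exists>D. ((\<lambda>t. U t (x t) (y t)) has_real_derivative D) (at t within T) \<and>
        D \<le> - l * U t (x t) (y t) + b * (\<bar>r1\<bar> + \<bar>r2\<bar>)))"

lemma strict_lyapunov_function:
  "\<exists>U cl cu l. 0 < cl \<and> 0 < cu \<and> 0 < l \<and>
    (\<forall>t x y. cl * (x\<^sup>2 + y\<^sup>2) \<le> U t x y \<and> U t x y \<le> cu * (x\<^sup>2 + y\<^sup>2)) \<and>
    (\<forall>M. \<exists>b\<ge>0. dissipative U l M b)"
proof -
  \<comment> \<open>\<open>G\<close> bounds the effect of the drift on \<Psi>. The first bound on
    \<eta> lets the loss of \<xi>^2 in \<open>V * sqrt V\<close> absorb what \<Psi> adds; the second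
    keeps \<open>U\<close> above half of the lower bound for \<open>V * sqrt V\<close>.\<close>
  define G where "G = 2 * (C1 + C2) * K / \<bar>\<Omega>\<bar>"
  define \<eta> where "\<eta> = min (4 * K * \<kappa> / 3 / (1 + 4 * G\<^sup>2)) (\<kappa> ^ 3 * \<bar>\<Omega>\<bar> / 4)"
  define U where "U = (\<lambda>t x y. V x y * sqrt (V x y) + \<eta> * \<Psi> t x y)"
  define cN where "cN = 4 * \<nu> ^ 3 + 2 * \<eta> / \<bar>\<Omega>\<bar>"
  \<comment> \<open>\<open>N\<close> retains the coefficient 3/16 \<eta>, which is 5/16 - 1/8 times
    \<eta>, and \<open>U\<close> is at most \<open>cN * N\<close>.\<close>
  define rate where "rate = 3 * \<eta> / (16 * cN)"
  define m where "m = min (C1\<^sup>2) (C2\<^sup>2)"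
  have g4: "0 < 1 + 4 * G\<^sup>2" by (simp add: add_pos_nonneg)
  have \<eta>: "0 < \<eta>" using K \<kappa>_pos \<Omega> g4 by (simp add: \<eta>_def)
  have "\<eta> \<le> 4 * K * \<kappa> / 3 / (1 + 4 * G\<^sup>2)" by (simp add: \<eta>_def)
  then have \<eta>1: "\<eta> * (1 + 4 * G\<^sup>2) \<le> 4 * K * \<kappa> / 3" by (rule pos_le_divide_eq[THEN iffD1, OF g4])
  have "\<eta> \<le> \<kappa> ^ 3 * \<bar>\<Omega>\<bar> / 4" by (simp add: \<eta>_def)
  then have \<eta>2: "2 * \<eta> / \<bar>\<Omega>\<bar> \<le> \<kappa> ^ 3 / 2" using \<Omega> by (simp add: field_simps)
  have cN: "0 < cN" using \<nu>_pos \<eta> by (simp add: cN_def add_pos_nonneg)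
  have rate: "0 < rate" using \<eta> cN by (simp add: rate_def)
  have m: "0 < m" using C1 C2 by (simp add: m_def)
  have N0: "0 \<le> N x y" for x y by (simp add: N_def)
  have \<eta>\<Psi>: "\<bar>\<eta> * \<Psi> t x y\<bar> \<le> 2 * \<eta> / \<bar>\<Omega>\<bar> * N x y" for t x y
    using mult_left_mono[OF abs_\<Psi>_le[of t x y], of \<eta>] \<eta> by (simp add: abs_mult mult_ac)
  have low: "\<kappa> ^ 3 / 2 * N x y \<le> U t x y" for t x y
  proof -
    have "2 * \<eta> / \<bar>\<Omega>\<bar> * N x y \<le> \<kappa> ^ 3 / 2 * N x y"
      by (intro mult_right_mono \<eta>2 N0)
    then show ?thesis using V32_bounds(1)[of x y] \<eta>\<Psi>[of t x y] unfolding U_def by linarith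
  qed
  have up: "U t x y \<le> cN * N x y" for t x y
    using V32_bounds(2)[of x y] \<eta>\<Psi>[of t x y] unfolding U_def cN_def ring_distribs by linarith
  have N_ge: "m * (x\<^sup>2 + y\<^sup>2) \<le> N x y" for x y
    unfolding N_def power_mult_distrib distrib_left
    by (intro add_mono mult_right_mono) (auto simp: m_def)
  have N_le: "N x y \<le> (C1\<^sup>2 + C2\<^sup>2) * (x\<^sup>2 + y\<^sup>2)" for x y
    unfolding N_def power_mult_distrib distrib_left
    by (intro add_mono mult_right_mono) auto
  have U_pos: "0 < \<kappa> ^ 3 / 2 * m" "0 < cN * (C1\<^sup>2 + C2\<^sup>2)" "0 < rate"
      using \<kappa>_pos m cN rate C1 C2 by (auto intro!: mult_pos_pos add_pos_pos)
  have U_ge: "\<kappa> ^ 3 / 2 * m * (x\<^sup>2 + y\<^sup>2) \<le> U t x y" for t x y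
    proof -
      have "\<kappa> ^ 3 / 2 * (m * (x\<^sup>2 + y\<^sup>2)) \<le> \<kappa> ^ 3 / 2 * N x y"
        using \<kappa>_pos by (intro mult_left_mono N_ge) simp
      also note low[of x y t]
      finally show ?thesis by (simp only: mult.assoc)
    qed
  have U_le: "U t x y \<le> cN * (C1\<^sup>2 + C2\<^sup>2) * (x\<^sup>2 + y\<^sup>2)" for t x y
    proof -
      note up[of t x y]
      also have "cN * N x y \<le> cN * ((C1\<^sup>2 + C2\<^sup>2) * (x\<^sup>2 + y\<^sup>2))"
        using cN by (intro mult_left_mono N_le) simp
      finally show ?thesis by (simp only: mult.assoc)
    qed
  have diss: "\<exists>b\<ge>0. dissipative U rate M b" for M
  proof -
    \<comment> \<open>The two summands bound the gradients of \<open>V * sqrt V\<close> and of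
      \<eta> \<Psi> on the square of half-width \<open>M\<close>.\<close>
    define b where "b = 2 * sqrt (V \<bar>M\<bar> \<bar>M\<bar>) * (gx \<bar>M\<bar> + gy \<bar>M\<bar>) + \<eta> * (2 / \<bar>\<Omega>\<bar>) * (C1 + C2)\<^sup>2 * \<bar>M\<bar>"
    have b0: "0 \<le> b"
      using C1 C2 \<eta> by (simp add: b_def gx_def gy_def V_nonneg)
    have "\<exists>D. ((\<lambda>t. U t (x t) (y t)) has_real_derivative D) (at t within T) \<and>
        D \<le> - rate * U t (x t) (y t) + b * (\<bar>r1\<bar> + \<bar>r2\<bar>)"
      if xM: "\<bar>x t\<bar> \<le> M" and yM: "\<bar>y t\<bar> \<le> M"
        and dx: "(x has_real_derivative - K * \<xi> t (x t) (y t) * cos (\<Omega> * t) + r1) (at t within T)"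
        and dy: "(y has_real_derivative - K * \<xi> t (x t) (y t) * sin (\<Omega> * t) + r2) (at t within T)"
      for x y t T r1 r2
    proof -
      define z where "z = \<xi> t (x t) (y t)"
      define c s where "c = cos (\<Omega> * t)" and "s = sin (\<Omega> * t)"
      define X Y where "X = C1 * x t" and "Y = C2 * y t"
      define P1 P2 P3 where "P1 = p1 (\<Omega> * t)" and "P2 = p2 (\<Omega> * t)" and "P3 = p3 (\<Omega> * t)"
      define x' y' where "x' = - K * z * c + r1" and "y' = - K * z * s + r2"
      define n where "n = N (x t) (y t)"
      define w where "w = sqrt (V (x t) (y t))"
      define Q1 Q2 where "Q1 = X * P1 + Y * P2" and "Q2 = X * P2 + Y * P3"
      let ?r = "\<bar>r1\<bar> + \<bar>r2\<bar>"
      have cs: "\<bar>c\<bar> \<le> 1" "\<bar>s\<bar> \<le> 1" by (simp_all add: c_def s_def)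
      have M0: "0 \<le> M" using xM by linarith
      have gM: "\<bar>gx (x t)\<bar> \<le> gx \<bar>M\<bar>" "\<bar>gy (y t)\<bar> \<le> gy \<bar>M\<bar>"
        using xM yM M0 C1 C2 by (auto simp: gx_def gy_def abs_mult real_root_abs[symmetric] intro!: mult_left_mono)
      have wM: "w \<le> sqrt (V \<bar>M\<bar> \<bar>M\<bar>)"
      proof -
        have "gx (x t) ^ 4 \<le> gx \<bar>M\<bar> ^ 4" "gy (y t) ^ 4 \<le> gy \<bar>M\<bar> ^ 4"
          using power_mono[OF gM(1), of 4] power_mono[OF gM(2), of 4] by simp_all
        then show ?thesis unfolding w_def V_eq
          using C1 C2 by (intro real_sqrt_le_mono add_mono divide_right_mono) auto
      qed
      have w0: "0 \<le> w" by (simp add: w_def V_nonneg)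
      define D where "D = 2 * w * (gx (x t) * x' + gy (y t) * y')
        + \<eta> * (z\<^sup>2 - 5 / 16 * n + 2 / \<Omega> * (x' * C1 * Q1 + y' * C2 * Q2))"
      have dU: "((\<lambda>t. U t (x t) (y t)) has_real_derivative D) (at t within T)"
        unfolding U_def D_def n_def z_def w_def Q1_def Q2_def X_def Y_def P1_def P2_def P3_def x'_def y'_def
            c_def s_def
        by (rule DERIV_add[OF DERIV_V32[OF dx dy] DERIV_cmult[OF DERIV_\<Psi>[OF dx dy]]])
      have first: "2 * w * (gx (x t) * x' + gy (y t) * y')
        \<le> - (4 * K * \<kappa> / 3) * z\<^sup>2 + 2 * sqrt (V \<bar>M\<bar> \<bar>M\<bar>) * (gx \<bar>M\<bar> + gy \<bar>M\<bar>) * ?r"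
      proof -
        have "2 * w * (gx (x t) * x' + gy (y t) * y')
          = - (2 * K) * (w * (gx (x t) * c + gy (y t) * s) * z) + 2 * w * (gx (x t) * r1 + gy (y t) * r2)"
          unfolding x'_def y'_def by algebra
        also have "\<dots> \<le> - (2 * K) * (2 * \<kappa> / 3 * z\<^sup>2) + 2 * sqrt (V \<bar>M\<bar> \<bar>M\<bar>) * ((gx \<bar>M\<bar> + gy \<bar>M\<bar>) * ?r)"
        proof (intro add_mono)
          show "- (2 * K) * (w * (gx (x t) * c + gy (y t) * s) * z) \<le> - (2 * K) * (2 * \<kappa> / 3 * z\<^sup>2)"
            using descent[of t "x t" "y t"] K by (intro mult_left_mono_neg) (auto simp: w_def c_def s_def z_def)
          have "gx (x t) * r1 + gy (y t) * r2 \<le> \<bar>gx (x t)\<bar> * \<bar>r1\<bar> + \<bar>gy (y t)\<bar> * \<bar>r2\<bar>"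
            by (intro add_mono) (auto simp: abs_mult[symmetric])
          also have "\<dots> \<le> gx \<bar>M\<bar> * \<bar>r1\<bar> + gy \<bar>M\<bar> * \<bar>r2\<bar>"
            by (intro add_mono mult_right_mono gM) auto
          also have "\<dots> \<le> (gx \<bar>M\<bar> + gy \<bar>M\<bar>) * ?r"
            using gM by (simp add: distrib_left distrib_right)
          finally have q: "gx (x t) * r1 + gy (y t) * r2 \<le> (gx \<bar>M\<bar> + gy \<bar>M\<bar>) * ?r" .
          have "0 \<le> (gx \<bar>M\<bar> + gy \<bar>M\<bar>) * ?r"
            using gM by (intro mult_nonneg_nonneg add_nonneg_nonneg) (auto intro: order_trans[OF abs_ge_zero])
          with q w0 wM show "2 * w * (gx (x t) * r1 + gy (y t) * r2) \<le> 2 * sqrt (V \<bar>M\<bar> \<bar>M\<bar>) * ((gx \<bar>M\<bar> + gy \<bar>M\<bar>)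
              * ?r)"
            by (intro order_trans[OF mult_left_mono mult_right_mono]) (auto simp: V_nonneg)
        qed
        finally show ?thesis by (simp add: mult_ac)
      qed
      define S where "S = \<bar>X\<bar> + \<bar>Y\<bar>"
      have S2: "S\<^sup>2 \<le> 2 * n"
        using zero_le_power2[of "\<bar>X\<bar> - \<bar>Y\<bar>"]
        by (simp add: S_def n_def N_def X_def[symmetric] Y_def[symmetric] power2_eq_square algebra_simps)
      have SM: "S \<le> (C1 + C2) * M"
        using C1 C2 xM yM unfolding S_def X_def Y_def distrib_right abs_mult
        by (intro add_mono) (auto intro!: mult_left_mono)
      have S0: "0 \<le> S" by (simp add: S_def)
      have Q: "\<bar>Q1\<bar> \<le> S" "\<bar>Q2\<bar> \<le> S"
        unfolding Q1_def Q2_def S_def P1_def P2_def P3_def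
        by (intro order_trans[OF abs_triangle_ineq] add_mono; simp add: abs_mult p_bounds mult_left_le)+
      have x': "\<bar>x'\<bar> \<le> K * \<bar>z\<bar> + ?r" "\<bar>y'\<bar> \<le> K * \<bar>z\<bar> + ?r"
      proof -
        have "\<bar>- K * z * c\<bar> \<le> K * \<bar>z\<bar>" "\<bar>- K * z * s\<bar> \<le> K * \<bar>z\<bar>"
          using K cs by (simp_all add: abs_mult mult_left_le)
        then show "\<bar>x'\<bar> \<le> K * \<bar>z\<bar> + ?r" "\<bar>y'\<bar> \<le> K * \<bar>z\<bar> + ?r"
          unfolding x'_def y'_def by linarith+
      qed
      have "\<bar>x' * C1 * Q1 + y' * C2 * Q2\<bar> \<le> \<bar>x'\<bar> * C1 * \<bar>Q1\<bar> + \<bar>y'\<bar> * C2 * \<bar>Q2\<bar>"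
        using C1 C2 by (intro order_trans[OF abs_triangle_ineq]) (simp add: abs_mult)
      also have "\<dots> \<le> (K * \<bar>z\<bar> + ?r) * C1 * S + (K * \<bar>z\<bar> + ?r) * C2 * S"
        using C1 C2 x' Q K S0 by (intro add_mono mult_mono) auto
      also have "\<dots> = (C1 + C2) * K * \<bar>z\<bar> * S + (C1 + C2) * ?r * S" by algebra
      also have "\<dots> \<le> (C1 + C2) * K * \<bar>z\<bar> * S + (C1 + C2) * ?r * ((C1 + C2) * M)"
        using C1 C2 K SM by (intro add_mono mult_left_mono) auto
      finally have "2 / \<bar>\<Omega>\<bar> * \<bar>x' * C1 * Q1 + y' * C2 * Q2\<bar> \<le>
          2 / \<bar>\<Omega>\<bar> * ((C1 + C2) * K * \<bar>z\<bar> * S + (C1 + C2) * ?r * ((C1 + C2) * M))"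
        by (intro mult_left_mono) auto
      also have "\<dots> = G * \<bar>z\<bar> * S + 2 / \<bar>\<Omega>\<bar> * (C1 + C2)\<^sup>2 * M * ?r"
        by (simp add: G_def power2_eq_square algebra_simps add_divide_distrib)
      finally have "\<bar>2 / \<Omega> * (x' * C1 * Q1 + y' * C2 * Q2)\<bar> \<le> G * \<bar>z\<bar> * S + 2 / \<bar>\<Omega>\<bar> * (C1 + C2)\<^sup>2 * M * ?r"
        by (simp only: abs_mult[of "2 / \<Omega>"] abs_divide abs_numeral)
      \<comment> \<open>Young's inequality, weighted so that \<open>S\<^sup>2 / 16\<close> costs at
        most n / 8 of the available 5/16 n.\<close>
      moreover have "G * \<bar>z\<bar> * S \<le> 4 * G\<^sup>2 * z\<^sup>2 + n / 8"
      proof -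
        have "0 \<le> (2 * G * \<bar>z\<bar> - S / 4)\<^sup>2" by simp
        also have "\<dots> = 4 * G\<^sup>2 * z\<^sup>2 + S\<^sup>2 / 16 - G * \<bar>z\<bar> * S"
          by (simp add: power2_diff power_mult_distrib power_divide)
        finally show ?thesis using S2 by linarith
      qed
      ultimately have "z\<^sup>2 - 5 / 16 * n + 2 / \<Omega> * (x' * C1 * Q1 + y' * C2 * Q2)
        \<le> (1 + 4 * G\<^sup>2) * z\<^sup>2 - 3 / 16 * n + 2 / \<bar>\<Omega>\<bar> * (C1 + C2)\<^sup>2 * M * ?r"
        unfolding distrib_right by linarith
      then have "\<eta> * (z\<^sup>2 - 5 / 16 * n + 2 / \<Omega> * (x' * C1 * Q1 + y' * C2 * Q2))
        \<le> \<eta> * ((1 + 4 * G\<^sup>2) * z\<^sup>2 - 3 / 16 * n + 2 / \<bar>\<Omega>\<bar> * (C1 + C2)\<^sup>2 * M * ?r)"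
        using \<eta> by (intro mult_left_mono) auto
      also have "\<dots> = \<eta> * (1 + 4 * G\<^sup>2) * z\<^sup>2 - 3 * \<eta> / 16 * n + \<eta> * (2 / \<bar>\<Omega>\<bar>) * (C1 + C2)\<^sup>2 * \<bar>M\<bar> * ?r"
        using M0 by (simp add: algebra_simps)
      \<comment> \<open>By \<open>\<eta>1\<close> the \<open>z\<^sup>2\<close> term contributed by
        \<Psi> is absorbed by the one in \<open>first\<close>, so only \<open>n\<close> and the
        errors remain.\<close>
      finally have "D \<le> - (3 * \<eta> / 16 * n) + b * ?r"
        using first mult_right_mono[OF \<eta>1 zero_le_power2[of z]] unfolding D_def b_def distrib_right[of "2 * sqrt
            (V \<bar>M\<bar> \<bar>M\<bar>) * (gx \<bar>M\<bar> + gy \<bar>M\<bar>)"] by linarith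
      moreover have "rate * U t (x t) (y t) \<le> 3 * \<eta> / 16 * n"
      proof -
        have "rate * U t (x t) (y t) \<le> rate * (cN * n)"
          using up rate unfolding n_def by (intro mult_left_mono) auto
        also have "\<dots> = 3 * \<eta> / 16 * n" using cN by (simp add: rate_def)
        finally show ?thesis .
      qed
      ultimately show ?thesis using dU by (intro exI[of _ D]) auto
    qed
    then have "dissipative U rate M b" unfolding dissipative_def by blast
    with b0 show ?thesis by blast
  qed
  show ?thesis using U_pos U_ge U_le diss by blast
qed

end

section \<open>Practical stability of the unicycle\<close>

locale seeking_unicycle =
  fixes C1 C2 xd yd a c \<Omega> :: real
  assumes C_pos: "0 < C1" "0 < C2" and ac_pos: "0 < a" "0 < c" and \<Omega>_nz: "\<Omega> \<noteq> 0"
begin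

sublocale quartic_flow C1 C2 "24 * a ^ 3 * c" \<Omega>
  using C_pos ac_pos \<Omega>_nz by unfold_locales auto

abbreviation field :: "real \<Rightarrow> real \<Rightarrow> real \<times> real \<Rightarrow> real \<times> real" where
  "field \<equiv> unicycle_field (quartic_cost C1 C2 (xd, yd)) a c \<Omega>"

definition dl :: "real \<Rightarrow> real" where "dl \<epsilon> = (\<epsilon> / (2 * pi)) powr (1 / 4)"

lemma dl_pos: "0 < \<epsilon> \<Longrightarrow> 0 < dl \<epsilon>"
  by (simp add: dl_def)

lemma dl_pow4: "0 < \<epsilon> \<Longrightarrow> dl \<epsilon> ^ 4 = \<epsilon> / (2 * pi)"
  by (simp add: dl_def powr_power)

text \<open>Amplitude and phases become \<delta>^-3, \<tau> and 3\<tau> with \<tau> = t /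
  \<delta>^4; the triple-angle formula then gives the shape of \<open>f\<close> in
  \<open>fast_family\<close>.\<close>

lemma velocity_eq:
  assumes "0 < \<epsilon>"
  shows "unicycle_velocity J a c \<epsilon> t X =
    (c * J X * (18 * sin (t / dl \<epsilon> ^ 4) - 24 * sin (t / dl \<epsilon> ^ 4) ^ 3) + 2 * a * cos (t / dl \<epsilon> ^ 4)) / dl \<epsilon> ^ 3"
proof -
  have "dl \<epsilon> ^ 3 = (\<epsilon> / (2 * pi)) powr (3 / 4)"
    using assms by (simp add: dl_def powr_power)
  also have "\<dots> = inverse ((2 * pi / \<epsilon>) powr (3 / 4))"
    using assms by (simp add: powr_divide)
  finally have p: "(2 * pi / \<epsilon>) powr (3 / 4) = 1 / dl \<epsilon> ^ 3"
    by (simp add: field_simps)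
  have \<tau>: "2 * pi * t / \<epsilon> = t / dl \<epsilon> ^ 4" "6 * pi * t / \<epsilon> = 3 * (t / dl \<epsilon> ^ 4)"
    using assms by (simp_all add: dl_pow4 mult_ac)
  have triple: "sin (3 * u) = 3 * sin u - 4 * sin u ^ 3" for u :: real
  proof -
    have "sin (3 * u) = sin (2 * u + u)" by simp
    also have "\<dots> = 2 * sin u * cos u * cos u + (cos u ^ 2 - sin u ^ 2) * sin u"
      unfolding sin_add sin_double cos_double by simp
    also have "\<dots> = 3 * sin u - 4 * sin u ^ 3"
      using sin_cos_squared_add[of u] by algebra
    finally show ?thesis .
  qed
  show ?thesis
    unfolding unicycle_velocity_def p \<tau> triple by (simp add: algebra_simps add_divide_distrib diff_divide_distrib)
qed

definition averaged_within :: "real \<Rightarrow> real \<Rightarrow> (real \<Rightarrow> real \<times> real) \<Rightarrow> (real \<Rightarrow> real) \<Rightarrow> (real \<Rightarrow> real) \<Rightarrow> bool" where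
  "averaged_within e S X zx zy \<longleftrightarrow> (\<forall>t\<in>{0..S}.
       \<bar>zx t - (fst (X t) - xd)\<bar> \<le> e \<and> \<bar>zy t - (snd (X t) - yd)\<bar> \<le> e \<and>
       (\<exists>r1 r2. \<bar>r1\<bar> \<le> e \<and> \<bar>r2\<bar> \<le> e \<and>
         (zx has_real_derivative - (24 * a ^ 3 * c) * \<xi> t (zx t) (zy t) * cos (\<Omega> * t) + r1) (at t within {0..S}) \<and>
         (zy has_real_derivative - (24 * a ^ 3 * c) * \<xi> t (zx t) (zy t) * sin (\<Omega> * t) + r2) (at t within {0..S})))"

definition confined :: "real \<Rightarrow> real \<Rightarrow> real \<Rightarrow> (real \<Rightarrow> real \<times> real) \<Rightarrow> bool" where
  "confined M \<epsilon> S X \<longleftrightarrow> (\<forall>t\<in>{0..S}. norm (X t - (xd, yd)) \<le> M \<and>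
     (X has_vector_derivative field \<epsilon> t (X t)) (at t within {0..S}))"

text \<open>The equation is only required inside the ball, so that solutions of the truncated system qualify as well.\<close>

definition solves_inside :: "real \<Rightarrow> real \<Rightarrow> real \<Rightarrow> (real \<Rightarrow> real \<times> real) \<Rightarrow> bool" where
  "solves_inside M \<epsilon> S X \<longleftrightarrow> continuous_on {0..S} X \<and> (\<forall>t\<in>{0..S}. norm (X t - (xd, yd)) \<le> M \<longrightarrow>
     (X has_vector_derivative field \<epsilon> t (X t)) (at t within {0..S}))"

text \<open>Since \<open>X\<close> moves along the heading, the corrector only has to shift \<open>X\<close> along the heading too.\<close>

lemma near_identity:
  "\<exists>C\<ge>0. \<forall>\<epsilon> S X. 0 < \<epsilon> \<longrightarrow> dl \<epsilon> \<le> 1 \<longrightarrow> confined M \<epsilon> S X \<longrightarrow>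
    (\<exists>zx zy. averaged_within (C * dl \<epsilon>) S X zx zy)"
proof -
  \<comment> \<open>Taking the triple as the index puts all parameters, horizons and trajectories
    into one family, so a single \<open>C\<close> serves them all.\<close>
  define I :: "(real \<times> real \<times> (real \<Rightarrow> real \<times> real)) set" where
    "I = {(\<epsilon>, S, X). 0 < \<epsilon> \<and> dl \<epsilon> \<le> 1 \<and> confined M \<epsilon> S X}"
  define \<delta> where "\<delta> = (\<lambda>i :: real \<times> real \<times> (real \<Rightarrow> real \<times> real). dl (fst i))"
  define S where "S = (\<lambda>i :: real \<times> real \<times> (real \<Rightarrow> real \<times> real). fst (snd i))"
  define X where "X = (\<lambda>i :: real \<times> real \<times> (real \<Rightarrow> real \<times> real). snd (snd i))"
  define x y where "x = (\<lambda>i t. fst (X i t) - xd)" and "y = (\<lambda>i t. snd (X i t) - yd)"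
  define ct st where "ct = (\<lambda>(i :: real \<times> real \<times> (real \<Rightarrow> real \<times> real)) t. cos (\<Omega> * t))"
    and "st = (\<lambda>(i :: real \<times> real \<times> (real \<Rightarrow> real \<times> real)) t. sin (\<Omega> * t))"
  \<comment> \<open>Successive derivatives of the cost in the direction of the heading, with the
    heading itself held fixed.\<close>
  define j0 where "j0 = (\<lambda>i t. C1 * x i t ^ 4 + C2 * y i t ^ 4)"
  define j1 where "j1 = (\<lambda>i t. 4 * (C1 * (x i t ^ 3 * ct i t) + C2 * (y i t ^ 3 * st i t)))"
  define j2 where "j2 = (\<lambda>i t. 12 * (C1 * (x i t ^ 2 * ct i t ^ 2) + C2 * (y i t ^ 2 * st i t ^ 2)))"
  define j3 where "j3 = (\<lambda>i t. 24 * (C1 * (x i t * ct i t ^ 3) + C2 * (y i t * st i t ^ 3)))"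
  define j4 where "j4 = (\<lambda>i t. 24 * (C1 * ct i t ^ 4 + C2 * st i t ^ 4))"
  interpret F: fast_family I \<delta> S a c j0
    by unfold_locales (auto simp: I_def \<delta>_def dl_pos)
  have inI: "norm (X i t - (xd, yd)) \<le> M"
      "(X i has_vector_derivative field (fst i) t (X i t)) (at t within {0..S i})" "0 < fst i"
    if "i \<in> I" "t \<in> {0..S i}" for i t
    using that by (auto simp: I_def X_def S_def confined_def)
  have vel: "unicycle_velocity (quartic_cost C1 C2 (xd, yd)) a c (fst i) t (X i t) = F.f i t / \<delta> i ^ 3"
    if "0 < fst i" for i t
    unfolding velocity_eq[OF that] F.f_def F.sn_def F.cn_def
    by (simp add: \<delta>_def j0_def x_def y_def quartic_cost_def)
  have bx: "\<bar>x i t\<bar> \<le> M" and by': "\<bar>y i t\<bar> \<le> M" if "i \<in> I" "t \<in> {0..S i}" for i t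
    using inI(1)[OF that] norm_fst_le[of "fst (X i t) - xd" "snd (X i t) - yd"]
      norm_snd_le[of "snd (X i t) - yd" "fst (X i t) - xd"]
    by (cases "X i t"; simp add: x_def y_def)+
  have dx: "(x i has_real_derivative F.f i t * ct i t / \<delta> i ^ 3) (at t within {0..S i})"
    and dy: "(y i has_real_derivative F.f i t * st i t / \<delta> i ^ 3) (at t within {0..S i})"
    if "i \<in> I" "t \<in> {0..S i}" for i t
  proof -
    have d: "((\<lambda>t. fst (X i t)) has_real_derivative fst (field (fst i) t (X i t))) (at t within {0..S i})"
      "((\<lambda>t. snd (X i t)) has_real_derivative snd (field (fst i) t (X i t))) (at t within {0..S i})"
      unfolding has_real_derivative_iff_has_vector_derivative
      by (fact bounded_linear.has_vector_derivative[OF bounded_linear_fst inI(2)[OF that]]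
        bounded_linear.has_vector_derivative[OF bounded_linear_snd inI(2)[OF that]])+
    have "((\<lambda>t. fst (X i t) - xd) has_real_derivative fst (field (fst i) t (X i t)) - 0) (at t within {0..S i})"
      "((\<lambda>t. snd (X i t) - yd) has_real_derivative snd (field (fst i) t (X i t)) - 0) (at t within {0..S i})"
      by (intro DERIV_diff d DERIV_const)+
    then show "(x i has_real_derivative F.f i t * ct i t / \<delta> i ^ 3) (at t within {0..S i})"
      "(y i has_real_derivative F.f i t * st i t / \<delta> i ^ 3) (at t within {0..S i})"
      by (simp_all add: unicycle_field_def vel[OF inI(3)[OF that]] x_def y_def ct_def st_def)
  qed
  have b: "F.bdd x" "F.bdd y" "F.bdd ct" "F.bdd st"
    unfolding F.bdd_def
    subgoal using bx by blast
    subgoal using by' by blast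
    by (auto simp: ct_def st_def intro: exI[of _ 1])
  have sx: "F.slow x ct" and sy: "F.slow y st"
    unfolding F.slow_def using b dx dy by (auto intro!: exI[of _ "\<lambda>i t. 0"])
  have dcs: "(ct i has_real_derivative - \<Omega> * st i t) (at t within {0..S i})"
      "(st i has_real_derivative \<Omega> * ct i t) (at t within {0..S i})" for i t
    unfolding ct_def st_def by (auto intro!: derivative_eq_intros)
  have bd: "F.bdd (\<lambda>i t. - \<Omega> * st i t)" "F.bdd (\<lambda>i t. \<Omega> * ct i t)"
    by (intro F.bdd_mult F.bdd_const b)+
  \<comment> \<open>The heading turns at bounded speed, so its rotation goes into the bounded
    remainder of \<open>slow\<close> and its derivative at order \<delta>^-3 is 0.\<close>
  have sct: "F.slow ct (\<lambda>i t. 0)"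
    by (rule F.slowI[OF b(3) F.bdd_const bd(1)]) (use dcs(1) in simp)
  have sst: "F.slow st (\<lambda>i t. 0)"
    by (rule F.slowI[OF b(4) F.bdd_const bd(2)]) (use dcs(2) in simp)
  note sl = F.slow_cong[OF F.slow_cmult[OF F.slow_add[OF F.slow_cmult F.slow_cmult]]]
  have s01: "F.slow j0 j1"
    by (rule sl[OF F.slow_power[OF sx, of 3] F.slow_power[OF sy, of 3], of 1 C1 C2])
      (simp_all add: j0_def j1_def algebra_simps)
  have s12: "F.slow j1 j2"
    by (rule sl[OF F.slow_mult[OF F.slow_power[OF sx, of 2] sct] F.slow_mult[OF F.slow_power[OF sy, of 2] sst],
        of 4 C1 C2])
      (simp_all add: j1_def j2_def eval_nat_numeral algebra_simps)
  have s23: "F.slow j2 j3"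
    by (rule sl[OF F.slow_mult[OF F.slow_power[OF sx, of 1] F.slow_power[OF sct, of 1]]
          F.slow_mult[OF F.slow_power[OF sy, of 1] F.slow_power[OF sst, of 1]], of 12 C1 C2])
      (simp_all add: j2_def j3_def eval_nat_numeral algebra_simps)
  have s34: "F.slow j3 j4"
    by (rule sl[OF F.slow_mult[OF sx F.slow_power[OF sct, of 2]] F.slow_mult[OF sy F.slow_power[OF sst, of 2]],
        of 24 C1 C2])
      (simp_all add: j3_def j4_def eval_nat_numeral algebra_simps)
  obtain W R where "F.bdd W" "F.bdd R" and dW: "\<And>i t. i \<in> I \<Longrightarrow> t \<in> {0..S i} \<Longrightarrow>
    ((\<lambda>t. \<delta> i * W i t) has_real_derivative F.f i t / \<delta> i ^ 3 + a ^ 3 * c * j3 i t + \<delta> i * R i t) (at t within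
        {0..S i})"
    by (rule F.neglE[OF F.fourth_order_average[OF s01 s12 s23 s34]], rule that)
  \<comment> \<open>Errors after shifting X by -\<delta> W along the heading, divided by \<delta>.
    The \<delta>^-3 terms cancel; what is left comes from evaluating \<open>j3\<close> at the
    shifted point (exactly \<delta> W j4, since \<open>j3\<close> is linear in the position), from
    \<open>R\<close>, and from the rotation of the heading.\<close>
  define r1 where "r1 = (\<lambda>i t. - (a ^ 3 * c) * W i t * j4 i t * ct i t - R i t * ct i t + \<Omega> * W i t * st i t)"
  define r2 where "r2 = (\<lambda>i t. - (a ^ 3 * c) * W i t * j4 i t * st i t - R i t * st i t - \<Omega> * W i t * ct i t)"
  have "F.bdd j4" using s34 by (simp add: F.slow_def)
  have "F.bdd r1" "F.bdd r2"
    unfolding r1_def r2_def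
    by (intro F.bdd_add F.bdd_diff F.bdd_mult F.bdd_const b \<open>F.bdd W\<close> \<open>F.bdd R\<close> \<open>F.bdd j4\<close>)+
  then obtain Q1 Q2 QW where Q: "\<And>i t. i \<in> I \<Longrightarrow> t \<in> {0..S i} \<Longrightarrow> \<bar>r1 i t\<bar> \<le> Q1"
      "\<And>i t. i \<in> I \<Longrightarrow> t \<in> {0..S i} \<Longrightarrow> \<bar>r2 i t\<bar> \<le> Q2" "\<And>i t. i \<in> I \<Longrightarrow> t \<in> {0..S i} \<Longrightarrow> \<bar>W i t\<bar> \<le> QW"
    using \<open>F.bdd W\<close> unfolding F.bdd_def by metis
  define C where "C = \<bar>Q1\<bar> + \<bar>Q2\<bar> + \<bar>QW\<bar>"
  have QC: "\<bar>r1 i t\<bar> \<le> C" "\<bar>r2 i t\<bar> \<le> C" "\<bar>W i t\<bar> \<le> C" if "i \<in> I" "t \<in> {0..S i}" for i t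
    using Q[OF that] unfolding C_def by linarith+
  have goal: "\<exists>zx zy. \<forall>t\<in>{0..S i}.
       \<bar>zx t - x i t\<bar> \<le> C * \<delta> i \<and> \<bar>zy t - y i t\<bar> \<le> C * \<delta> i \<and>
       (\<exists>r1 r2. \<bar>r1\<bar> \<le> C * \<delta> i \<and> \<bar>r2\<bar> \<le> C * \<delta> i \<and>
         (zx has_real_derivative - (24 * a ^ 3 * c) * \<xi> t (zx t) (zy t) * cos (\<Omega> * t) + r1) (at t within {0..S i}) \<and>
         (zy has_real_derivative - (24 * a ^ 3 * c) * \<xi> t (zx t) (zy t) * sin (\<Omega> * t) + r2) (at t within {0..S i}))"
    if i: "i \<in> I" for i
  proof (intro exI ballI conjI)
    let ?zx = "\<lambda>t. x i t - \<delta> i * W i t * ct i t" and ?zy = "\<lambda>t. y i t - \<delta> i * W i t * st i t"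
    fix t assume t: "t \<in> {0..S i}"
    have \<delta>: "0 < \<delta> i" using F.\<delta>_bounds[OF i] by simp
    have cs1: "\<bar>ct i t\<bar> \<le> 1" "\<bar>st i t\<bar> \<le> 1" by (simp_all add: ct_def st_def)
    have C0: "0 \<le> C" by (simp add: C_def)
    have "\<bar>W i t\<bar> * \<bar>ct i t\<bar> \<le> C * 1" "\<bar>W i t\<bar> * \<bar>st i t\<bar> \<le> C * 1"
      using QC[OF i t] cs1 C0 by (intro mult_mono; simp)+
    then show "\<bar>?zx t - x i t\<bar> \<le> C * \<delta> i" "\<bar>?zy t - y i t\<bar> \<le> C * \<delta> i"
      using \<delta> by (simp_all add: abs_mult mult_ac)
    show "\<bar>\<delta> i * r1 i t\<bar> \<le> C * \<delta> i" "\<bar>\<delta> i * r2 i t\<bar> \<le> C * \<delta> i"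
      using QC[OF i t] \<delta> by (simp_all add: abs_mult mult_ac)
    have j3z: "j3 i t = 24 * \<xi> t (?zx t) (?zy t) + \<delta> i * (W i t * j4 i t)"
      unfolding j3_def j4_def \<xi>_def ct_def st_def by (simp add: eval_nat_numeral algebra_simps)
    show "(?zx has_real_derivative - (24 * a ^ 3 * c) * \<xi> t (?zx t) (?zy t) * cos (\<Omega> * t) + \<delta> i * r1 i t) (at t
        within {0..S i})"
      by (rule DERIV_cong[OF DERIV_diff[OF dx[OF i t] DERIV_mult[OF dW[OF i t] dcs(1)]]])
        (simp add: j3z r1_def, simp add: ct_def algebra_simps)
    show "(?zy has_real_derivative - (24 * a ^ 3 * c) * \<xi> t (?zx t) (?zy t) * sin (\<Omega> * t) + \<delta> i * r2 i t) (at t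
        within {0..S i})"
      by (rule DERIV_cong[OF DERIV_diff[OF dy[OF i t] DERIV_mult[OF dW[OF i t] dcs(2)]]])
        (simp add: j3z r2_def, simp add: st_def algebra_simps)
  qed
  have "\<exists>zx zy. averaged_within (C * dl \<epsilon>) S' X' zx zy"
    if "0 < \<epsilon>" "dl \<epsilon> \<le> 1" "confined M \<epsilon> S' X'" for \<epsilon> S' X'
    using goal[of "(\<epsilon>, S', X')"] that
    by (simp add: averaged_within_def x_def y_def \<delta>_def S_def X_def I_def)
  moreover have "0 \<le> C" by (simp add: C_def)
  ultimately show ?thesis by blast
qed

text \<open>The order of choices avoids circularity: \<open>M\<close> depends only on a Lyapunov
  level of the initial ball, then \<open>C\<close> and \<open>b\<close> are taken for this
  \<open>M\<close>, and \<epsilon>0 last. The errors are then too small to let a trajectory reach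
  radius \<open>M\<close>.\<close>

lemma trajectory_bound:
  assumes r: "0 \<le> r"
  shows "\<exists>M \<epsilon>0 q l B. 0 < M \<and> 0 < \<epsilon>0 \<and> 0 < q \<and> 0 < l \<and>
    (\<forall>\<epsilon> S X t. 0 < \<epsilon> \<longrightarrow> \<epsilon> < \<epsilon>0 \<longrightarrow> solves_inside M \<epsilon> S X \<longrightarrow> norm (X 0 - (xd, yd)) \<le> r \<longrightarrow>
      t \<in> {0..S} \<longrightarrow>
      norm (X t - (xd, yd)) < M \<and> norm (X t - (xd, yd)) \<le> q * exp (- l * t) + B * sqrt (dl \<epsilon>))"
proof -
  obtain U cl cu rate where pos: "0 < cl" "0 < cu" "0 < rate"
    and U: "\<forall>t x y. cl * (x\<^sup>2 + y\<^sup>2) \<le> U t x y \<and> U t x y \<le> cu * (x\<^sup>2 + y\<^sup>2)"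
    and lyap: "\<forall>M. \<exists>b\<ge>0. dissipative U rate M b"
    using strict_lyapunov_function by blast
  have U_ge: "cl * (x\<^sup>2 + y\<^sup>2) \<le> U t x y" and U_le: "U t x y \<le> cu * (x\<^sup>2 + y\<^sup>2)" for t x y
    using U by auto
  \<comment> \<open>\<open>H\<close> bounds \<open>U\<close> initially, the corrected coordinates
    being at most r + 1. While \<open>U\<close> is at most H + 1 the corrected position has norm at
    most \<open>m\<close>, so X stays within 2 m + 1, strictly below \<open>M\<close>.\<close>
  define H where "H = cu * (2 * (r + 1)\<^sup>2)"
  define m where "m = sqrt ((H + 1) / cl)"
  define M where "M = 2 * m + 2"
  have H: "0 < H" using pos r by (simp add: H_def)
  have M0: "0 < M" using H pos by (simp add: M_def m_def add_nonneg_pos)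
  obtain C where C: "0 \<le> C" and ni: "\<And>\<epsilon> S X. 0 < \<epsilon> \<Longrightarrow> dl \<epsilon> \<le> 1 \<Longrightarrow> confined M \<epsilon> S X \<Longrightarrow>
      \<exists>zx zy. averaged_within (C * dl \<epsilon>) S X zx zy"
    using near_identity[of M] by blast
  obtain b where b: "0 \<le> b" and dU: "dissipative U rate (M + 1) b"
    using lyap by blast
  \<comment> \<open>This enforces \<open_bound>: the shift is at most 1/2 and the stationary level
    of the Gronwall estimate at most 1. The summands 1 keep the denominators positive when C = 0 or
    b = 0.\<close>
  define \<delta>0 where "\<delta>0 = min 1 (min (1 / (2 * C + 1)) (rate / (2 * b * C + 1)))"
  define \<epsilon>0 where "\<epsilon>0 = 2 * pi * \<delta>0 ^ 4"
  \<comment> \<open>\<open>U\<close> is quadratic, so taking roots halves the decay rate and turns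
    an O(\<delta>) level into O(\<delta>^(1/2)); the shift itself is O(\<delta>), below
    \<delta>^(1/2) as \<delta> \<le> 1.\<close>
  define q where "q = 2 * sqrt (H / cl)"
  define B where "B = 2 * sqrt (2 * b * C / (rate * cl)) + 2 * C"
  have bC: "0 \<le> b * C" using b C by simp
  have \<delta>0: "0 < \<delta>0" using C bC pos by (simp add: \<delta>0_def add_nonneg_pos)
  have small: "dl \<epsilon> \<le> 1 \<and> C * dl \<epsilon> \<le> 1 / 2 \<and> 2 * b * C * dl \<epsilon> / rate \<le> 1" if "0 < \<epsilon>" "\<epsilon> < \<epsilon>0" for \<epsilon>
  proof -
    have d0: "0 < dl \<epsilon>" using that dl_pos by simp
    have "dl \<epsilon> ^ 4 < \<delta>0 ^ 4"
      using that by (simp add: dl_pow4 \<epsilon>0_def field_simps)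
    then have d: "dl \<epsilon> < \<delta>0" by (rule power_less_imp_less_base) (use \<delta>0 in simp)
    then have "dl \<epsilon> < 1 / (2 * C + 1)" "dl \<epsilon> < rate / (2 * b * C + 1)" by (simp_all add: \<delta>0_def)
    then have "dl \<epsilon> * (2 * C + 1) < 1" "dl \<epsilon> * (2 * b * C + 1) < rate"
      using C bC by (simp_all add: pos_less_divide_eq add_nonneg_pos mult.assoc)
    then have "2 * C * dl \<epsilon> < 1" "2 * b * C * dl \<epsilon> < rate" using d0 by (simp_all add: algebra_simps)
    moreover have "dl \<epsilon> \<le> 1" using d by (simp add: \<delta>0_def)
    ultimately show ?thesis using pos by (simp add: pos_divide_le_eq)
  qed
  \<comment> \<open>First for trajectories assumed to stay in the closed ball; the strict inequality
    is what lets the continuation argument remove this assumption.\<close>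
  have bound: "norm (X t - (xd, yd)) < M \<and> norm (X t - (xd, yd)) \<le> q * exp (- (rate / 2) * t) + B * sqrt (dl \<epsilon>)"
    if \<epsilon>: "0 < \<epsilon>" "\<epsilon> < \<epsilon>0" and X0: "norm (X 0 - (xd, yd)) \<le> r"
      and X: "confined M \<epsilon> S X"
      and t: "t \<in> {0..S}" for \<epsilon> S t X
  proof -
    define \<delta> where "\<delta> = dl \<epsilon>"
    have \<delta>: "0 < \<delta>" "\<delta> \<le> 1" "C * \<delta> \<le> 1 / 2" "2 * b * C * \<delta> / rate \<le> 1"
      using small[OF \<epsilon>] dl_pos[OF \<epsilon>(1)] by (simp_all add: \<delta>_def)
    obtain zx zy where "averaged_within (C * \<delta>) S X zx zy"
      using ni[OF \<epsilon>(1) _ X] \<delta>(2) unfolding \<delta>_def by blast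
    note z = this[unfolded averaged_within_def, rule_format]
    have comp: "\<bar>fst (X t) - xd\<bar> \<le> norm (X t - (xd, yd))" "\<bar>snd (X t) - yd\<bar> \<le> norm (X t - (xd, yd))"
      "norm (X t - (xd, yd)) \<le> \<bar>fst (X t) - xd\<bar> + \<bar>snd (X t) - yd\<bar>" for t
      using norm_fst_le[of "fst (X t) - xd" "snd (X t) - yd"] norm_snd_le[of "snd (X t) - yd" "fst (X t) - xd"]
        norm_Pair_le[of "fst (X t) - xd" "snd (X t) - yd"]
      by (cases "X t"; simp)+
    let ?u = "\<lambda>t. U t (zx t) (zy t)"
    have "\<exists>D. (?u has_real_derivative D) (at s within {0..S}) \<and> D \<le> - rate * ?u s + 2 * b * C * \<delta>"
      if s: "s \<in> {0..S}" for s
    proof -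
      \<comment> \<open>The extra 1 in \<open>M + 1\<close> leaves room for the near-identity
        shift.\<close>
      have "\<bar>zx s\<bar> \<le> M + 1" "\<bar>zy s\<bar> \<le> M + 1"
        using z[OF s] comp[of s] X[unfolded confined_def, rule_format, OF s] \<delta>(3) by linarith+
      moreover obtain r1 r2 where r: "\<bar>r1\<bar> \<le> C * \<delta>" "\<bar>r2\<bar> \<le> C * \<delta>"
         "(zx has_real_derivative - (24 * a ^ 3 * c) * \<xi> s (zx s) (zy s) * cos (\<Omega> * s) + r1) (at s within {0..S})"
         "(zy has_real_derivative - (24 * a ^ 3 * c) * \<xi> s (zx s) (zy s) * sin (\<Omega> * s) + r2) (at s within {0..S})"
        using z[OF s] by blast
      ultimately obtain D where D: "(?u has_real_derivative D) (at s within {0..S})"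
          "D \<le> - rate * ?u s + b * (\<bar>r1\<bar> + \<bar>r2\<bar>)"
        using dU unfolding dissipative_def by blast
      have "b * (\<bar>r1\<bar> + \<bar>r2\<bar>) \<le> b * (2 * (C * \<delta>))"
        using r b by (intro mult_left_mono) auto
      then show ?thesis using D by (intro exI[of _ D]) (simp add: mult_ac)
    qed
    then have "?u t \<le> exp (- rate * t) * ?u 0 + 2 * b * C * \<delta> / rate"
      by (rule gronwall_dissipative) (use pos mult_nonneg_nonneg[OF bC, of \<delta>] \<delta> t in \<open>auto simp: mult_ac\<close>)
    moreover have "?u 0 \<le> H"
    proof -
      have "0 \<in> {0..S}" using t by simp
      from z[OF this] comp[of 0] X0 \<delta>(3) have "\<bar>zx 0\<bar> \<le> r + 1" "\<bar>zy 0\<bar> \<le> r + 1" by linarith+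
      then have "(zx 0)\<^sup>2 \<le> (r + 1)\<^sup>2" "(zy 0)\<^sup>2 \<le> (r + 1)\<^sup>2"
        using power_mono[of "\<bar>zx 0\<bar>" "r + 1" 2] power_mono[of "\<bar>zy 0\<bar>" "r + 1" 2] by auto
      then have "cu * ((zx 0)\<^sup>2 + (zy 0)\<^sup>2) \<le> H"
        unfolding H_def using pos by (intro mult_left_mono) auto
      then show ?thesis using U_le[of 0 "zx 0" "zy 0"] by linarith
    qed
    then have "exp (- rate * t) * ?u 0 \<le> exp (- rate * t) * H" by (intro mult_left_mono) auto
    ultimately have "cl * ((zx t)\<^sup>2 + (zy t)\<^sup>2) \<le> exp (- rate * t) * H + 2 * b * C * \<delta> / rate"
      using U_ge[of "zx t" "zy t" t] by linarith
    then have zz: "(zx t)\<^sup>2 + (zy t)\<^sup>2 \<le> (exp (- rate * t) * H + 2 * b * C * \<delta> / rate) / cl"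
      using pos by (simp add: pos_le_divide_eq mult.commute)
    define \<rho> where "\<rho> = sqrt ((zx t)\<^sup>2 + (zy t)\<^sup>2)"
    have "\<bar>zx t\<bar> \<le> \<rho>" "\<bar>zy t\<bar> \<le> \<rho>" unfolding \<rho>_def by (rule real_sqrt_ge_abs1 real_sqrt_ge_abs2)+
    then have n: "norm (X t - (xd, yd)) \<le> 2 * \<rho> + 2 * (C * \<delta>)"
      using comp(3)[of t] z[OF t] by linarith
    have "exp (- rate * t) * H \<le> 1 * H"
      using H pos t by (intro mult_right_mono) auto
    then have "(exp (- rate * t) * H + 2 * b * C * \<delta> / rate) / cl \<le> (H + 1) / cl"
      using \<delta>(4) pos by (intro divide_right_mono) linarith+
    then have "\<rho> \<le> m" unfolding \<rho>_def m_def using zz by (intro real_sqrt_le_mono) linarith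
    then have 1: "norm (X t - (xd, yd)) < M" using n \<delta>(3) unfolding M_def by linarith
    have "\<rho> \<le> sqrt (exp (- rate * t) * H / cl + 2 * b * C * \<delta> / rate / cl)"
      unfolding \<rho>_def using zz by (intro real_sqrt_le_mono) (simp add: add_divide_distrib)
    also have "\<dots> \<le> sqrt (exp (- rate * t) * H / cl) + sqrt (2 * b * C * \<delta> / rate / cl)"
      using H pos b C \<delta>(1) by (intro sqrt_add_le_add_sqrt) auto
    also have "sqrt (exp (- rate * t) * H / cl) = sqrt (H / cl) * exp (- (rate / 2) * t)"
    proof -
      have "exp (- rate * t) = (exp (- (rate / 2) * t))\<^sup>2" by (simp add: power2_eq_square exp_add[symmetric])
      then have "exp (- rate * t) * H / cl = H / cl * (exp (- (rate / 2) * t))\<^sup>2" by simp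
      then show ?thesis by (simp only: real_sqrt_mult real_sqrt_abs) simp
    qed
    also have "sqrt (2 * b * C * \<delta> / rate / cl) = sqrt (2 * b * C / (rate * cl)) * sqrt \<delta>"
      by (simp add: real_sqrt_mult[symmetric])
    finally have "2 * \<rho> \<le> q * exp (- (rate / 2) * t) + 2 * sqrt (2 * b * C / (rate * cl)) * sqrt \<delta>"
      by (simp add: q_def)
    moreover have "2 * (C * \<delta>) \<le> 2 * C * sqrt \<delta>"
    proof -
      have "\<delta> \<le> sqrt \<delta>" using \<delta> by (intro real_le_rsqrt) (simp add: power2_eq_square mult_left_le)
      then show ?thesis using C by (simp add: mult_left_mono)
    qed
    ultimately have "norm (X t - (xd, yd)) \<le> q * exp (- (rate / 2) * t) + B * sqrt \<delta>"
      using n unfolding B_def distrib_right by linarith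
    with 1 show ?thesis by (simp add: \<delta>_def)
  qed
  have main: "norm (X t - (xd, yd)) < M \<and> norm (X t - (xd, yd)) \<le> q * exp (- (rate / 2) * t) + B * sqrt (dl \<epsilon>)"
    if \<epsilon>: "0 < \<epsilon>" "\<epsilon> < \<epsilon>0" and X: "solves_inside M \<epsilon> S X" and X0: "norm (X 0 - (xd, yd)) \<le> r"
      and t: "t \<in> {0..S}" for \<epsilon> S X t
  proof -
    have cont: "continuous_on {0..S} X" using X by (simp add: solves_inside_def)
    have X': "confined M \<epsilon> s X" if "s \<in> {0..S}" "\<And>u. u \<in> {0..s} \<Longrightarrow> norm (X u - (xd, yd)) \<le> M" for s
      unfolding confined_def
    proof
      fix u assume u: "u \<in> {0..s}"
      then have "(X has_vector_derivative field \<epsilon> u (X u)) (at u within {0..S})"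
        using that X by (auto simp: solves_inside_def)
      then show "norm (X u - (xd, yd)) \<le> M \<and> (X has_vector_derivative field \<epsilon> u (X u)) (at u within {0..s})"
        using that u by (auto intro: has_vector_derivative_within_subset)
    qed
    \<comment> \<open>Both bounds on \<open>U\<close>, evaluated at (r + 1, 0), compare
      \<open>cl\<close> with \<open>cu\<close>, whence r + 1 \<le> m.\<close>
    have "r < M"
    proof -
      have "(r + 1)\<^sup>2 \<le> (H + 1) / cl"
      proof -
        have "cl * ((r + 1)\<^sup>2 + 0\<^sup>2) \<le> cu * ((r + 1)\<^sup>2 + 0\<^sup>2)"
          using U_ge U_le by (rule order_trans)
        moreover have "0 \<le> cu * (r + 1)\<^sup>2" using pos by simp
        ultimately have "cl * (r + 1)\<^sup>2 \<le> H + 1" unfolding H_def by simp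
        then show ?thesis using pos by (simp add: pos_le_divide_eq mult.commute)
      qed
      then have "r + 1 \<le> m" unfolding m_def by (rule real_le_rsqrt)
      then show ?thesis unfolding M_def using r by linarith
    qed
    have lt: "norm (X u - (xd, yd)) < M" if "u \<in> {0..S}" for u
      using that
    proof (rule continuous_bootstrap[rotated 3])
      show "continuous_on {0..S} (\<lambda>u. norm (X u - (xd, yd)))" by (intro continuous_intros cont)
      show "norm (X 0 - (xd, yd)) < M" using X0 \<open>r < M\<close> by simp
      fix s assume s: "s \<in> {0..S}" "\<And>u. u \<in> {0..s} \<Longrightarrow> norm (X u - (xd, yd)) \<le> M"
      show "norm (X s - (xd, yd)) < M"
        using bound[OF \<epsilon> X0 X'[OF s], of s] s(1) by simp
    qed
    then have "confined M \<epsilon> S X"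
      using X unfolding confined_def solves_inside_def by (meson less_imp_le)
    from bound[OF \<epsilon> X0 this t] show ?thesis .
  qed
  have "0 < M" "0 < \<epsilon>0" "0 < q" "0 < rate / 2"
    using M0 \<delta>0 H pos by (simp_all add: \<epsilon>0_def q_def)
  with main show ?thesis by blast
qed

text \<open>The field is polynomial in the position and only locally Lipschitz. Precomposing it with
  the nonexpansive projection onto a ball makes it globally Lipschitz, without changing it inside
  the ball.\<close>

lemma truncated_solution:
  assumes "0 < \<epsilon>" "0 < M" "0 \<le> T"
  shows "\<exists>X. ivp_solution (\<lambda>t x. field \<epsilon> t (closest_point (cball (xd, yd) M) x)) X0 T X"
proof -
  let ?p = "closest_point (cball (xd, yd) M)" and ?J = "quartic_cost C1 C2 (xd, yd)"
  have ne: "cball (xd, yd) M \<noteq> {}" using assms by simp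
  have pc: "continuous_on UNIV ?p"
    by (rule continuous_on_closest_point) (use ne in auto)
  have pM: "\<bar>fst (?p x) - xd\<bar> \<le> M" "\<bar>snd (?p x) - yd\<bar> \<le> M" for x
  proof -
    have "?p x \<in> cball (xd, yd) M" by (rule closest_point_in_set) (use ne in auto)
    then have "dist (xd, yd) (?p x) \<le> M" by simp
    then show "\<bar>fst (?p x) - xd\<bar> \<le> M" "\<bar>snd (?p x) - yd\<bar> \<le> M"
      using dist_fst_le[of "(xd, yd)" "?p x"] dist_snd_le[of "(xd, yd)" "?p x"]
      by (auto simp: dist_real_def)
  qed
  have pl: "norm (?p x - ?p y) \<le> norm (x - y)" for x y
    using closest_point_lipschitz[of "cball (xd, yd) M" x y] ne by (simp add: dist_norm)
  have q4: "\<bar>u ^ 4 - v ^ 4\<bar> \<le> 4 * M ^ 3 * \<bar>u - v\<bar>" if "\<bar>u\<bar> \<le> M" "\<bar>v\<bar> \<le> M" for u v :: real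
  proof -
    have "u ^ 4 - v ^ 4 = (u ^ 3 + u ^ 2 * v + u * v ^ 2 + v ^ 3) * (u - v)" by algebra
    moreover have "\<bar>u ^ 3 + u ^ 2 * v + u * v ^ 2 + v ^ 3\<bar> \<le> 4 * M ^ 3"
    proof -
      have "\<bar>u ^ 3\<bar> \<le> M ^ 3" "\<bar>v ^ 3\<bar> \<le> M ^ 3" "\<bar>u ^ 2 * v\<bar> \<le> M ^ 2 * M" "\<bar>u * v ^ 2\<bar> \<le> M * M ^ 2"
        using that by (simp_all only: power_abs abs_mult) (intro mult_mono power_mono; simp)+
      moreover have "M ^ 2 * M = M ^ 3" "M * M ^ 2 = M ^ 3" by (simp_all add: eval_nat_numeral)
      moreover have "\<bar>p + q + r + s\<bar> \<le> 4 * k"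
        if "\<bar>p\<bar> \<le> k" "\<bar>s\<bar> \<le> k" "\<bar>q\<bar> \<le> k" "\<bar>r\<bar> \<le> k" for p q r s k :: real
        using that by linarith
      ultimately show ?thesis by metis
    qed
    ultimately show ?thesis by (simp add: abs_mult mult_right_mono)
  qed
  define A where "A = 2 * (2 * pi / \<epsilon>) powr (3 / 4)"
  define L where "L = 2 * (A * (3 * c) * ((C1 + C2) * (4 * M ^ 3))) + 1"
  have A: "0 \<le> A" by (simp add: A_def)
  have L: "0 < L" unfolding L_def using A C_pos ac_pos assms by (simp add: add_nonneg_pos)
  show ?thesis
  proof (rule picard_global[OF assms(3) L])
    have "continuous_on ({0..T} \<times> UNIV) (\<lambda>z. ?p (snd z))"
      by (rule continuous_on_compose2[OF pc]) (auto intro!: continuous_intros)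
    then show "continuous_on ({0..T} \<times> UNIV) (\<lambda>(t, x). field \<epsilon> t (?p x))"
      unfolding unicycle_field_def unicycle_velocity_def quartic_cost_def case_prod_unfold
      by (intro continuous_intros) (use assms in auto)
    fix t x y
    have "\<bar>?J (?p x) - ?J (?p y)\<bar> \<le> C1 * \<bar>(fst (?p x) - xd) ^ 4 - (fst (?p y) - xd) ^ 4\<bar>
        + C2 * \<bar>(snd (?p x) - yd) ^ 4 - (snd (?p y) - yd) ^ 4\<bar>"
    proof -
      have "?J (?p x) - ?J (?p y) = C1 * ((fst (?p x) - xd) ^ 4 - (fst (?p y) - xd) ^ 4)
        + C2 * ((snd (?p x) - yd) ^ 4 - (snd (?p y) - yd) ^ 4)"
        by (simp add: quartic_cost_def algebra_simps)
      then show ?thesis using C_pos abs_triangle_ineq by (simp add: abs_mult order_trans[OF abs_triangle_ineq])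
    qed
    also have "\<dots> \<le> C1 * (4 * M ^ 3 * norm (x - y)) + C2 * (4 * M ^ 3 * norm (x - y))"
    proof (intro add_mono mult_left_mono)
      have "\<bar>fst (?p x) - xd - (fst (?p y) - xd)\<bar> \<le> norm (x - y)" "\<bar>snd (?p x) - yd - (snd (?p y) - yd)\<bar> \<le> norm
          (x - y)"
        using pl[of x y] dist_fst_le[of "?p x" "?p y"] dist_snd_le[of "?p x" "?p y"]
        by (simp_all add: dist_real_def dist_norm)
      then show "\<bar>(fst (?p x) - xd) ^ 4 - (fst (?p y) - xd) ^ 4\<bar> \<le> 4 * M ^ 3 * norm (x - y)"
        "\<bar>(snd (?p x) - yd) ^ 4 - (snd (?p y) - yd) ^ 4\<bar> \<le> 4 * M ^ 3 * norm (x - y)"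
        using assms by (auto intro!: order_trans[OF q4[OF pM(1) pM(1)] mult_left_mono] order_trans[OF q4[OF
            pM(2) pM(2)] mult_left_mono])
    qed (use C_pos in auto)
    finally have J: "\<bar>?J (?p x) - ?J (?p y)\<bar> \<le> (C1 + C2) * (4 * M ^ 3) * norm (x - y)"
      by (simp add: algebra_simps)
    let ?v = "\<lambda>x. unicycle_velocity ?J a c \<epsilon> t (?p x)"
    have "\<bar>?v x - ?v y\<bar> = A * (3 * c) * (\<bar>?J (?p x) - ?J (?p y)\<bar> * \<bar>sin (6 * pi * t / \<epsilon>)\<bar>)"
    proof -
      have "?v x - ?v y = A * (3 * c) * ((?J (?p x) - ?J (?p y)) * sin (6 * pi * t / \<epsilon>))"
        unfolding unicycle_velocity_def A_def[symmetric] by (simp add: algebra_simps)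
      then show ?thesis using A ac_pos by (simp add: abs_mult)
    qed
    also have "\<dots> \<le> A * (3 * c) * ((C1 + C2) * (4 * M ^ 3) * norm (x - y))"
      using A ac_pos J by (intro mult_left_mono order_trans[OF mult_left_le J]) auto
    finally have v: "\<bar>?v x - ?v y\<bar> \<le> A * (3 * c) * ((C1 + C2) * (4 * M ^ 3) * norm (x - y))" .
    have "field \<epsilon> t (?p x) - field \<epsilon> t (?p y) = ((?v x - ?v y) * cos (\<Omega> * t), (?v x - ?v y) * sin (\<Omega> * t))"
      by (simp add: unicycle_field_def algebra_simps)
    then have "norm (field \<epsilon> t (?p x) - field \<epsilon> t (?p y)) \<le>
        \<bar>(?v x - ?v y) * cos (\<Omega> * t)\<bar> + \<bar>(?v x - ?v y) * sin (\<Omega> * t)\<bar>"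
      using norm_Pair_le[of "(?v x - ?v y) * cos (\<Omega> * t)" "(?v x - ?v y) * sin (\<Omega> * t)"] by simp
    also have "\<dots> \<le> \<bar>?v x - ?v y\<bar> + \<bar>?v x - ?v y\<bar>"
      unfolding abs_mult by (intro add_mono mult_left_le) auto
    also have "\<dots> \<le> 2 * (A * (3 * c) * ((C1 + C2) * (4 * M ^ 3) * norm (x - y))) + norm (x - y)"
      using v norm_ge_zero[of "x - y"] by linarith
    also have "\<dots> = L * norm (x - y)"
      by (simp add: L_def algebra_simps)
    finally show "norm (field \<epsilon> t (?p x) - field \<epsilon> t (?p y)) \<le> L * norm (x - y)" .
  qed
qed

lemma dl_tendsto_0: "(dl \<longlongrightarrow> 0) (at_right 0)"
proof -
  have "((\<lambda>\<epsilon>. (\<epsilon> / (2 * pi)) powr (1 / 4)) \<longlongrightarrow> (0 / (2 * pi)) powr (1 / 4)) (at_right 0)"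
    by (intro tendsto_powr' tendsto_intros)
      (auto simp: eventually_at_filter intro!: eventually_mono[OF eventually_True])
  then show ?thesis by (simp add: dl_def[abs_def])
qed

text \<open>A ball around the minimum containing \<open>D\<close> provides one \<epsilon>0 for all
  initial conditions in \<open>D\<close>; the constants q, l and the residual turn out to be common
  to \<open>D\<close> as well.\<close>

lemma practical_stability:
  assumes "compact D"
  shows "practically_exponentially_stable field (xd, yd) D"
proof -
  obtain r where r: "0 \<le> r" "\<And>x. x \<in> D \<Longrightarrow> norm (x - (xd, yd)) \<le> r"
  proof -
    obtain r0 where "\<forall>x\<in>D. dist (xd, yd) x \<le> r0"
      using compact_imp_bounded[OF assms] bounded_any_center by blast
    then show thesis by (intro that[of "max 0 r0"]) (auto simp: dist_norm norm_minus_commute le_max_iff_disj)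
  qed
  obtain M \<epsilon>0 q l B where pos: "0 < M" "0 < \<epsilon>0" "0 < q" "0 < l"
    and bnd: "\<And>\<epsilon> S X t. 0 < \<epsilon> \<Longrightarrow> \<epsilon> < \<epsilon>0 \<Longrightarrow> solves_inside M \<epsilon> S X \<Longrightarrow> norm (X 0 - (xd, yd)) \<le> r \<Longrightarrow>
      t \<in> {0..S} \<Longrightarrow>
      norm (X t - (xd, yd)) < M \<and> norm (X t - (xd, yd)) \<le> q * exp (- l * t) + B * sqrt (dl \<epsilon>)"
    using trajectory_bound[OF r(1)] by blast
  \<comment> \<open>A solution of the truncated system satisfies \<open>solves_inside\<close>, so by
    the a priori bound it never reaches the sphere of radius \<open>M\<close> and therefore solves
    the original system. This excludes finite escape.\<close>
  have ex: "\<exists>X. ivp_solution (field \<epsilon>) X0 T X" if \<epsilon>: "0 < \<epsilon>" "\<epsilon> < \<epsilon>0" and "X0 \<in> D" and T: "0 < T" for \<epsilon> X0 T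
  proof -
    obtain X where "ivp_solution (\<lambda>t x. field \<epsilon> t (closest_point (cball (xd, yd) M) x)) X0 T X"
      using truncated_solution[OF \<epsilon>(1) pos(1)] T by (meson less_imp_le)
    then have X: "X 0 = X0" "\<And>t. t \<in> {0..T} \<Longrightarrow>
        (X has_vector_derivative field \<epsilon> t (closest_point (cball (xd, yd) M) (X t))) (at t within {0..T})"
      by (auto simp: ivp_solution_def)
    have in_ball: "(X has_vector_derivative field \<epsilon> t (X t)) (at t within {0..T})"
      if "t \<in> {0..T}" "norm (X t - (xd, yd)) \<le> M" for t
      using X(2)[OF that(1)] that(2) by (simp add: closest_point_self dist_norm norm_minus_commute)
    have "continuous_on {0..T} X"
      using X(2) by (rule continuous_on_vector_derivative)
    then have "solves_inside M \<epsilon> T X" using in_ball by (simp add: solves_inside_def)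
    then have "norm (X t - (xd, yd)) < M" if "t \<in> {0..T}" for t
      using bnd[OF \<epsilon> _ _ that] X(1) r(2)[OF \<open>X0 \<in> D\<close>] by blast
    then show ?thesis
      using X(1) in_ball unfolding ivp_solution_def by (intro exI[of _ X]) (simp add: less_imp_le)
  qed
  have decay: "norm (X t - (xd, yd)) \<le> q * exp (- l * t) + B * sqrt (dl \<epsilon>)"
    if "0 < \<epsilon>" "\<epsilon> < \<epsilon>0" "X0 \<in> D" "ivp_solution (field \<epsilon>) X0 T X" "t \<in> {0..T}" for \<epsilon> X0 T X t
  proof -
    have X: "X 0 = X0" "\<And>t. t \<in> {0..T} \<Longrightarrow> (X has_vector_derivative field \<epsilon> t (X t)) (at t within {0..T})"
      using that(4) by (auto simp: ivp_solution_def)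
    have "continuous_on {0..T} X" using X(2) by (rule continuous_on_vector_derivative)
    then have "solves_inside M \<epsilon> T X" using X(2) by (simp add: solves_inside_def)
    from bnd[OF that(1,2) this _ that(5)] show ?thesis using X(1) r(2)[OF that(3)] by blast
  qed
  have "((\<lambda>\<epsilon>. B * sqrt (dl \<epsilon>)) \<longlongrightarrow> B * sqrt 0) (at_right 0)"
    by (intro tendsto_intros dl_tendsto_0)
  then have d0: "((\<lambda>\<epsilon>. B * sqrt (dl \<epsilon>)) \<longlongrightarrow> 0) (at_right 0)" by simp
  show ?thesis
    unfolding practically_exponentially_stable_def
    by (rule exI[of _ \<epsilon>0], intro conjI ballI pos(2), rule exI[of _ q], intro conjI pos(3),
        rule exI[of _ l], intro conjI pos(4), rule exI[of _ "\<lambda>\<epsilon>. B * sqrt (dl \<epsilon>)"])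
      (use d0 ex decay in blast)
qed

end

theorem theorem2:
  fixes C1 C2 xd yd a c \<Omega> :: real and D :: "(real \<times> real) set"
  assumes "C1 > 0" and "C2 > 0" and "a > 0" and "c > 0" and "\<Omega> \<noteq> 0"
    and "compact D" and "(xd, yd) \<in> D"
  shows "practically_exponentially_stable
           (unicycle_field (quartic_cost C1 C2 (xd, yd)) a c \<Omega>) (xd, yd) D"
proof -
  interpret seeking_unicycle C1 C2 xd yd a c \<Omega>
    using assms by unfold_locales
  show ?thesis by (rule practical_stability[OF assms(6)])
qed

end
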